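(* Let $K$ be an algebraically closed field, $S=K[y_0,\dots,y_n]$, $\mathfrak M=(y_0,\dots,y_n)$, and let $\mathfrak I\subset S$ be a homogeneous ideal with $\mathfrak I^{sat}\subsetneq\mathfrak M$. Let $\mathcal B(\mathfrak I)=(b_1,\dots,b_h,c_1,\dots,c_k)$ be a standard basis of $\mathfrak I$ such that $T=(c_1,\dots,c_k)$ is a maximal (with respect to inclusion) inessential subset of $\mathcal B(\mathfrak I)$. Then, for the dehomogenization $\mathfrak I_*$ of $\mathfrak I$ with respect to any nonzero linear form $L$, the set $\mathcal B_L(\mathfrak I_* )=(b_{1*},\dots,b_{h*})$ generates $\mathfrak I_*$. Moreover, there are finitely many proper $K$-linear subspaces of the $K$-vector space $\mathfrak M_1$ of linear forms such that, for nonzero $L\in\mathfrak M_1$, the set $\mathcal B_L(\mathfrak I_* )$ fails to be a basis of $\mathfrak I_*$ if and only if $L$ lies in the union of these subspaces.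
   Context: For a homogeneous ideal $\mathfrak I$, $\mathfrak I^{sat}=\{f\in S:\ f\,\mathfrak M^t\subseteq\mathfrak I\text{ for some }t\in\mathbb N\}$. A standard basis of $\mathfrak I$ is an ordered set of forms generating $\mathfrak I$ such that, for each $d$, its elements of degree $d$ define a $K$-basis of $\mathfrak I_d/(\mathfrak I_{d-1}S_1)$. A subset $T$ of a standard basis $\mathcal B(\mathfrak I)$ is inessential if $\mathfrak I^{sat}=(\mathcal B(\mathfrak I)\setminus T)^{sat}$, the saturation of the ideal generated by $\mathcal B(\mathfrak I)\setminus T$. Dehomogenization with respect to a nonzero linear form $L$: after a linear change of coordinates with $L=y_0$, a form $F(y_0,\dots,y_n)$ is sent to $F_*(x_1,\dots,x_n)=F(1,x_1,\dots,x_n)\in K[x_1,\dots,x_n]$, and $\mathfrak I_*$ is the image of $\mathfrak I$ under this map (equivalently, its image in $S/(L-1)S$). A basis of an ideal $\mathfrak J\subseteq K[x_1,\dots,x_n]$ is a system of generators that fails to generate $\mathfrak J$ if any one of its elements is omitted. *)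

theory Defs
  imports
    "HOL-Library.Poly_Mapping"
    "HOL-Computational_Algebra.Polynomial"
    "HOL-Combinatorics.Transposition"
    "HOL-Algebra.Ideal_Product"
begin

section \<open>Polynomial rings in finitely many of the variables \<open>y\<^sub>0, y\<^sub>1, \<dots>\<close>\<close>

text \<open>
  A polynomial maps power products, that is finitely supported exponent functions, to
  coefficients.  The rings \<open>K[y\<^sub>0,\<dots>,y\<^sub>n]\<close> and \<open>K[x\<^sub>1,\<dots>,x\<^sub>n]\<close> are both subrings of the ring of
  polynomials in countably many variables, the variable \<open>x\<^sub>i\<close> being identified with \<open>y\<^sub>i\<close>.
\<close>

type_synonym 'k mpoly = "(nat \<Rightarrow>\<^sub>0 nat) \<Rightarrow>\<^sub>0 'k"

definition var :: "nat \<Rightarrow> 'k::comm_ring_1 mpoly"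
  where "var i = Poly_Mapping.single (Poly_Mapping.single i 1) 1"

definition const :: "'k::comm_ring_1 \<Rightarrow> 'k mpoly"
  where "const c = Poly_Mapping.single 0 c"

definition polys :: "nat set \<Rightarrow> 'k::comm_ring_1 mpoly set"
  where "polys V = {p. \<forall>m\<in>Poly_Mapping.keys p. Poly_Mapping.keys m \<subseteq> V}"

definition poly_ring :: "nat set \<Rightarrow> 'k::comm_ring_1 mpoly ring"
  where "poly_ring V = \<lparr>carrier = polys V, mult = (*), one = 1, zero = 0, add = (+)\<rparr>"

abbreviation S_ring :: "nat \<Rightarrow> 'k::comm_ring_1 mpoly ring"
  where "S_ring n \<equiv> poly_ring {0..n}"

abbreviation affine_ring :: "nat \<Rightarrow> 'k::comm_ring_1 mpoly ring"
  where "affine_ring n \<equiv> poly_ring {1..n}"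

definition scale :: "'k::comm_ring_1 \<Rightarrow> 'k mpoly \<Rightarrow> 'k mpoly"
  where "scale c p = const c * p"

interpretation mpoly: vector_space "scale :: 'k::field \<Rightarrow> 'k mpoly \<Rightarrow> 'k mpoly"
  by unfold_locales
    (simp_all add: scale_def const_def algebra_simps single_add mult_single
      flip: mult.assoc)

definition subst :: "(nat \<Rightarrow> 'k::comm_ring_1 mpoly) \<Rightarrow> 'k mpoly \<Rightarrow> 'k mpoly"
  where "subst \<sigma> p = (\<Sum>m\<in>Poly_Mapping.keys p.
    const (Poly_Mapping.lookup p m) *
      (\<Prod>i\<in>Poly_Mapping.keys m. \<sigma> i ^ Poly_Mapping.lookup m i))"


section \<open>Forms, homogeneous ideals and saturation\<close>

definition mdeg :: "(nat \<Rightarrow>\<^sub>0 nat) \<Rightarrow> nat"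
  where "mdeg m = (\<Sum>i\<in>Poly_Mapping.keys m. Poly_Mapping.lookup m i)"

text \<open>The homogeneous component \<open>S\<^sub>d\<close> of \<open>S = K[y\<^sub>0,\<dots>,y\<^sub>n]\<close>; it contains \<open>0\<close>.\<close>

definition forms :: "nat \<Rightarrow> nat \<Rightarrow> 'k::comm_ring_1 mpoly set"
  where "forms n d = {p \<in> polys {0..n}. \<forall>m\<in>Poly_Mapping.keys p. mdeg m = d}"

definition homogeneous_ideal :: "nat \<Rightarrow> 'k::comm_ring_1 mpoly set \<Rightarrow> bool"
  where "homogeneous_ideal n I \<longleftrightarrow>
    ideal I (S_ring n) \<and> (\<exists>G \<subseteq> (\<Union>d. forms n d). I = Idl\<^bsub>S_ring n\<^esub> G)"

definition irrelevant_ideal :: "nat \<Rightarrow> 'k::comm_ring_1 mpoly set"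
  where "irrelevant_ideal n = Idl\<^bsub>S_ring n\<^esub> (var ` {0..n})"

definition saturation :: "nat \<Rightarrow> 'k::comm_ring_1 mpoly set \<Rightarrow> 'k mpoly set"
  where "saturation n I = {f \<in> polys {0..n}.
    \<exists>t::nat. \<forall>g \<in> irrelevant_ideal n [^]\<^bsub>ideals_set (S_ring n)\<^esub> t. f * g \<in> I}"


section \<open>Standard bases and inessential subsets\<close>

text \<open>
  \<open>old_part n I d\<close> is the space \<open>I\<^sub>d\<^sub>-\<^sub>1 S\<^sub>1\<close>; for \<open>d = 0\<close> there are no products, and it is \<open>0\<close>.
\<close>

definition old_part :: "nat \<Rightarrow> 'k::field mpoly set \<Rightarrow> nat \<Rightarrow> 'k mpoly set"
  where "old_part n I d =
    mpoly.span {f * l | f l e. d = Suc e \<and> f \<in> I \<inter> forms n e \<and> l \<in> forms n 1}"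

text \<open>
  The classes of the elements of \<open>B\<close> form a basis of the quotient space \<open>U/W\<close>, indexed by \<open>B\<close>:
  they generate it and are linearly independent (so that in particular they are distinct).
\<close>

definition quotient_basis :: "'k::field mpoly set \<Rightarrow> 'k mpoly set \<Rightarrow> 'k mpoly set \<Rightarrow> bool"
  where "quotient_basis U W B \<longleftrightarrow>
    B \<subseteq> U \<and>
    (\<forall>g\<in>U. \<exists>h\<in>mpoly.span B. g - h \<in> W) \<and>
    (\<forall>A a. finite A \<and> A \<subseteq> B \<and> (\<Sum>b\<in>A. scale (a b) b) \<in> W \<longrightarrow> (\<forall>b\<in>A. a b = 0))"

definition standard_basis :: "nat \<Rightarrow> 'k::field mpoly set \<Rightarrow> 'k mpoly list \<Rightarrow> bool"
  where "standard_basis n I B \<longleftrightarrow>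
    distinct B \<and>
    set B \<subseteq> (\<Union>d. forms n d) \<and>
    Idl\<^bsub>S_ring n\<^esub> (set B) = I \<and>
    (\<forall>d. quotient_basis (I \<inter> forms n d) (old_part n I d) (set B \<inter> forms n d))"

definition inessential :: "nat \<Rightarrow> 'k::field mpoly set \<Rightarrow> 'k mpoly list \<Rightarrow> 'k mpoly set \<Rightarrow> bool"
  where "inessential n I B T \<longleftrightarrow>
    T \<subseteq> set B \<and> saturation n I = saturation n (Idl\<^bsub>S_ring n\<^esub> (set B - T))"

definition maximal_inessential ::
    "nat \<Rightarrow> 'k::field mpoly set \<Rightarrow> 'k mpoly list \<Rightarrow> 'k mpoly set \<Rightarrow> bool"
  where "maximal_inessential n I B T \<longleftrightarrow>
    inessential n I B T \<and> (\<forall>T'. inessential n I B T' \<and> T \<subseteq> T' \<longrightarrow> T' = T)"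


section \<open>Dehomogenization\<close>

text \<open>
  A linear change of coordinates replaces each \<open>y\<^sub>i\<close> by a linear form \<open>\<sigma> i\<close> in the new
  coordinates (again called \<open>y\<^sub>0,\<dots>,y\<^sub>n\<close>), in an invertible way.  It is adapted to \<open>L\<close> if \<open>L\<close>
  becomes the new coordinate \<open>y\<^sub>0\<close>.
\<close>

definition adapted_coords ::
    "nat \<Rightarrow> 'k::comm_ring_1 mpoly \<Rightarrow> (nat \<Rightarrow> 'k mpoly) \<Rightarrow> bool"
  where "adapted_coords n L \<sigma> \<longleftrightarrow>
    bij_betw (subst \<sigma>) (forms n 1) (forms n 1) \<and> subst \<sigma> L = var 0"

text \<open>The form is first written in the new coordinates, then \<open>y\<^sub>0\<close> is set to \<open>1\<close>.\<close>

definition dehom :: "(nat \<Rightarrow> 'k::comm_ring_1 mpoly) \<Rightarrow> 'k mpoly \<Rightarrow> 'k mpoly"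
  where "dehom \<sigma> F = subst (\<lambda>i. if i = 0 then 1 else var i) (subst \<sigma> F)"

definition ideal_basis :: "nat \<Rightarrow> 'k::comm_ring_1 mpoly set \<Rightarrow> 'k mpoly set \<Rightarrow> bool"
  where "ideal_basis n J B \<longleftrightarrow>
    B \<subseteq> polys {1..n} \<and> Idl\<^bsub>affine_ring n\<^esub> B = J \<and>
    (\<forall>b\<in>B. Idl\<^bsub>affine_ring n\<^esub> (B - {b}) \<noteq> J)"


section \<open>Basic facts\<close>

lemma polys_add: "p \<in> polys V \<Longrightarrow> q \<in> polys V \<Longrightarrow> p + q \<in> polys V"
  using keys_add[of p q] unfolding polys_def by blast

lemma polys_uminus: "p \<in> polys V \<Longrightarrow> - p \<in> polys V"
  by (simp add: polys_def keys_minus)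

lemma polys_mult:
  assumes "p \<in> polys V" "q \<in> polys V"
  shows "p * q \<in> polys V"
  unfolding polys_def
proof (intro CollectI ballI)
  fix m assume "m \<in> Poly_Mapping.keys (p * q)"
  then obtain a b where "m = a + b" "a \<in> Poly_Mapping.keys p" "b \<in> Poly_Mapping.keys q"
    using keys_mult[of p q] by blast
  then show "Poly_Mapping.keys m \<subseteq> V"
    using keys_add[of a b] assms unfolding polys_def by blast
qed

lemma cring_poly_ring: "cring (poly_ring V :: 'k::comm_ring_1 mpoly ring)"
proof (rule cringI)
  show "abelian_group (poly_ring V :: 'k mpoly ring)"
  proof (rule abelian_groupI)
    fix x assume "x \<in> carrier (poly_ring V :: 'k mpoly ring)"
    then show "\<exists>y\<in>carrier (poly_ring V). y \<oplus>\<^bsub>poly_ring V\<^esub> x = \<zero>\<^bsub>poly_ring V\<^esub>"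
      by (intro bexI[of _ "- x"]) (auto simp: poly_ring_def polys_uminus)
  qed (auto simp: poly_ring_def polys_add algebra_simps, simp add: polys_def)
  show "comm_monoid (poly_ring V :: 'k mpoly ring)"
    by (rule comm_monoidI)
      (auto simp: poly_ring_def polys_mult algebra_simps, simp add: polys_def)
qed (simp add: poly_ring_def algebra_simps)

lemma subst_superset:
  assumes "finite A" "Poly_Mapping.keys p \<subseteq> A"
  shows "subst \<sigma> p = (\<Sum>m\<in>A. const (Poly_Mapping.lookup p m) *
      (\<Prod>i\<in>Poly_Mapping.keys m. \<sigma> i ^ Poly_Mapping.lookup m i))"
  unfolding subst_def using assms
  by (intro sum.mono_neutral_left) (auto simp: in_keys_iff const_def)

lemma subst_add: "subst \<sigma> (p + q) = subst \<sigma> p + subst \<sigma> q"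
proof -
  let ?A = "Poly_Mapping.keys p \<union> Poly_Mapping.keys q"
  have *: "finite ?A" by simp
  show ?thesis
    unfolding subst_superset[OF * keys_add] subst_superset[OF * Un_upper1]
      subst_superset[OF * Un_upper2]
    by (simp add: lookup_add const_def single_add algebra_simps sum.distrib)
qed

lemma lookup_scale: "Poly_Mapping.lookup (scale c p) m = c * Poly_Mapping.lookup p m"
  unfolding scale_def const_def mult_map_scale_conv_mult[symmetric]
  by (simp add: Poly_Mapping.map.rep_eq when_def)

lemma keys_scale: "Poly_Mapping.keys (scale c p) \<subseteq> Poly_Mapping.keys p"
  by (auto simp: in_keys_iff lookup_scale)

lemma subst_scale: "subst \<sigma> (scale c p) = scale c (subst \<sigma> p)"
proof -
  have "subst \<sigma> (scale c p) = (\<Sum>m\<in>Poly_Mapping.keys p. scale c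
      (const (Poly_Mapping.lookup p m) *
        (\<Prod>i\<in>Poly_Mapping.keys m. \<sigma> i ^ Poly_Mapping.lookup m i)))"
    unfolding subst_superset[OF finite_keys keys_scale]
  proof (rule sum.cong[OF refl])
    fix m
    show "const (Poly_Mapping.lookup (scale c p) m) *
        (\<Prod>i\<in>Poly_Mapping.keys m. \<sigma> i ^ Poly_Mapping.lookup m i) =
        scale c (const (Poly_Mapping.lookup p m) *
        (\<Prod>i\<in>Poly_Mapping.keys m. \<sigma> i ^ Poly_Mapping.lookup m i))"
      unfolding lookup_scale
      by (simp add: scale_def const_def mult_single flip: mult.assoc)
  qed
  then show ?thesis
    by (simp add: subst_def scale_def sum_distrib_left)
qed

lemma subst_sum: "subst \<sigma> (sum f A) = (\<Sum>x\<in>A. subst \<sigma> (f x))"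
  by (induction A rule: infinite_finite_induct) (simp_all add: subst_add, simp_all add: subst_def)

lemma subst_diff: "subst \<sigma> (p - q) = subst \<sigma> p - subst \<sigma> q"
  using subst_add[of \<sigma> "p - q" q] by simp

lemma subst_var: "subst \<sigma> (var i) = \<sigma> i"
  by (simp add: subst_def var_def const_def del: single_one) simp

lemma forms_add: "p \<in> forms n d \<Longrightarrow> q \<in> forms n d \<Longrightarrow> p + q \<in> forms n d"
  using keys_add[of p q] by (auto simp: forms_def polys_add)

lemma forms_diff: "p \<in> forms n d \<Longrightarrow> q \<in> forms n d \<Longrightarrow> p - q \<in> forms n d"
  using forms_add[of p n d "- q"] by (simp add: forms_def polys_uminus keys_minus)

lemma forms_scale: "p \<in> forms n d \<Longrightarrow> scale c p \<in> forms n d"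
  using keys_scale[of c p] by (auto simp: forms_def polys_def)

lemma forms_sum: "(\<And>x. x \<in> A \<Longrightarrow> f x \<in> forms n d) \<Longrightarrow> sum f A \<in> forms n d"
  by (induction A rule: infinite_finite_induct)
    (auto simp: forms_add, auto simp: forms_def polys_def)

lemma var_in_forms: "i \<le> n \<Longrightarrow> var i \<in> forms n 1"
  by (auto simp: forms_def polys_def var_def mdeg_def split: if_splits)

lemma linear_form_expand:
  fixes L :: "'k::comm_ring_1 mpoly"
  assumes "L \<in> forms n 1"
  shows "L = (\<Sum>i\<le>n. scale (Poly_Mapping.lookup L (Poly_Mapping.single i 1)) (var i))"
proof (rule poly_mapping_eqI)
  fix m
  have lv: "Poly_Mapping.lookup (var i :: 'k mpoly) m = (if m = Poly_Mapping.single i 1 then 1 else 0)"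
    for i by (auto simp: var_def lookup_single when_def)
  let ?s = "Poly_Mapping.lookup (\<Sum>i\<le>n. scale (Poly_Mapping.lookup L (Poly_Mapping.single i 1)) (var i)) m"
  have s: "?s = (\<Sum>i\<le>n. if m = Poly_Mapping.single i 1
      then Poly_Mapping.lookup L (Poly_Mapping.single i 1) else 0)"
    by (auto simp: lookup_sum lookup_scale lv intro!: sum.cong)
  show "Poly_Mapping.lookup L m = ?s"
  proof (cases "\<exists>i\<le>n. m = Poly_Mapping.single i 1")
    case True
    then obtain k where k: "k \<le> n" "m = Poly_Mapping.single k 1" by blast
    have "?s = (\<Sum>i\<le>n. if i = k then Poly_Mapping.lookup L m else 0)"
    proof (unfold s, intro sum.cong refl)
      fix i
      have "m = Poly_Mapping.single i 1 \<longleftrightarrow> i = k"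
        by (metis k(2) lookup_single_eq lookup_single_not_eq zero_neq_one)
      then show "(if m = Poly_Mapping.single i 1
          then Poly_Mapping.lookup L (Poly_Mapping.single i 1) else 0) =
          (if i = k then Poly_Mapping.lookup L m else 0)"
        using k(2) by simp
    qed
    then show ?thesis using k by simp
  next
    case False
    then have "?s = 0" unfolding s by (auto intro!: sum.neutral)
    moreover have "m \<notin> Poly_Mapping.keys L"
    proof
      assume "m \<in> Poly_Mapping.keys L"
      then have d: "mdeg m = 1" and v: "Poly_Mapping.keys m \<subseteq> {0..n}"
        using assms by (auto simp: forms_def polys_def)
      from d obtain k where k: "k \<in> Poly_Mapping.keys m" "Poly_Mapping.lookup m k = 1"
        and z: "\<forall>j\<in>Poly_Mapping.keys m. k \<noteq> j \<longrightarrow> Poly_Mapping.lookup m j = 0"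
        unfolding mdeg_def by (subst (asm) sum_eq_1_iff) auto
      have "m = Poly_Mapping.single k 1"
        by (rule poly_mapping_eqI) (use k z in \<open>auto simp: lookup_single when_def in_keys_iff\<close>)
      then show False using False k v by auto
    qed
    ultimately show ?thesis by (simp add: in_keys_iff)
  qed
qed

lemma subst_linear_form:
  assumes "L \<in> forms n 1"
  shows "subst \<sigma> L = (\<Sum>i\<le>n. scale (Poly_Mapping.lookup L (Poly_Mapping.single i 1)) (\<sigma> i))"
  by (subst linear_form_expand[OF assms]) (simp add: subst_sum subst_scale subst_var)

text \<open>Every nonzero linear form admits an adapted linear change of coordinates.\<close>

lemma adapted_coords_exist:
  fixes L :: "'k::field mpoly"
  assumes L: "L \<in> forms n 1" "L \<noteq> 0"
  shows "\<exists>\<sigma>. adapted_coords n L \<sigma>"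
proof -
  define c where "c i = Poly_Mapping.lookup L (Poly_Mapping.single i 1)" for i
  have Lc: "L = (\<Sum>i\<le>n. scale (c i) (var i))"
    unfolding c_def by (rule linear_form_expand[OF L(1)])
  obtain k where k: "k \<le> n" "c k \<noteq> 0"
  proof -
    have "\<exists>k\<le>n. c k \<noteq> 0"
    proof (rule ccontr)
      assume "\<not> ?thesis"
      then have "L = 0" by (subst Lc) (auto intro!: sum.neutral)
      with L(2) show False ..
    qed
    then show thesis using that by blast
  qed
  define \<pi> where "\<pi> = transpose 0 k"
  have \<pi>\<pi>: "\<pi> (\<pi> i) = i" for i by (simp add: \<pi>_def)
  have \<pi>0: "\<pi> i = 0 \<longleftrightarrow> i = k" for i by (auto simp: \<pi>_def transpose_eq_iff)
  have \<pi>n: "\<pi> i \<le> n" if "i \<le> n" for i using that k by (auto simp: \<pi>_def transpose_def)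
  define \<sigma> :: "nat \<Rightarrow> 'k mpoly" where "\<sigma> i = (if i = k
    then scale (inverse (c k)) (var 0 - (\<Sum>j\<in>{..n}-{k}. scale (c j) (var (\<pi> j))))
    else var (\<pi> i))" for i
  define \<tau> :: "nat \<Rightarrow> 'k mpoly" where "\<tau> i = (if i = 0 then L else var (\<pi> i))" for i
  have \<sigma>f: "\<sigma> i \<in> forms n 1" if "i \<le> n" for i
  proof (cases "i = k")
    case True
    have "scale (inverse (c k)) (var 0 - (\<Sum>j\<in>{..n}-{k}. scale (c j) (var (\<pi> j)))) \<in> forms n 1"
      by (intro forms_scale forms_diff forms_sum var_in_forms \<pi>n) auto
    then show ?thesis using True by (simp add: \<sigma>_def)
  next
    case False
    then show ?thesis by (simp add: \<sigma>_def var_in_forms \<pi>n that del: One_nat_def)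
  qed
  have \<tau>f: "\<tau> i \<in> forms n 1" if "i \<le> n" for i
    by (simp add: \<tau>_def L var_in_forms \<pi>n that del: One_nat_def)
  have \<sigma>maps: "subst \<sigma> p \<in> forms n 1" if "p \<in> forms n 1" for p
    unfolding subst_linear_form[OF that] by (intro forms_sum forms_scale \<sigma>f) auto
  have \<tau>maps: "subst \<tau> p \<in> forms n 1" if "p \<in> forms n 1" for p
    unfolding subst_linear_form[OF that] by (intro forms_sum forms_scale \<tau>f) auto
  have split: "(\<Sum>i\<le>n. g i) = g k + (\<Sum>i\<in>{..n}-{k}. g i)" for g :: "nat \<Rightarrow> 'k mpoly"
    using k by (simp add: sum.remove)
  have \<sigma>L: "subst \<sigma> L = var 0"
  proof -
    have "subst \<sigma> L = (\<Sum>i\<le>n. scale (c i) (\<sigma> i))"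
      by (subst Lc) (simp add: subst_sum subst_scale subst_var)
    also have "\<dots> = scale (c k) (\<sigma> k) + (\<Sum>i\<in>{..n}-{k}. scale (c i) (var (\<pi> i)))"
      unfolding split by (simp add: \<sigma>_def)
    also have "\<dots> = var 0"
      using k by (simp add: \<sigma>_def)
    finally show ?thesis .
  qed
  have \<sigma>\<tau>: "subst \<sigma> (\<tau> i) = var i" for i
  proof (cases "i = 0")
    case True
    then show ?thesis by (simp add: \<tau>_def \<sigma>L)
  next
    case False
    then have "\<pi> i \<noteq> k" using \<pi>0[of "\<pi> i"] by (simp add: \<pi>\<pi>)
    with False show ?thesis by (simp add: \<tau>_def subst_var \<sigma>_def \<pi>\<pi>)
  qed
  have \<tau>\<pi>: "subst \<tau> (var (\<pi> i)) = var i" if "i \<noteq> k" for i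
    using that by (simp add: subst_var \<tau>_def \<pi>0 \<pi>\<pi>)
  have \<tau>\<sigma>: "subst \<tau> (\<sigma> i) = var i" for i
  proof (cases "i = k")
    case True
    have "subst \<tau> (\<sigma> k) = scale (inverse (c k))
        (L - (\<Sum>j\<in>{..n}-{k}. scale (c j) (var j)))"
      by (simp add: \<sigma>_def subst_scale subst_diff subst_sum \<tau>\<pi>) (simp add: subst_var \<tau>_def)
    also have "L - (\<Sum>j\<in>{..n}-{k}. scale (c j) (var j)) = scale (c k) (var k)"
      by (subst Lc) (simp add: split)
    finally show ?thesis using True k by simp
  next
    case False
    then show ?thesis by (simp add: \<sigma>_def \<tau>\<pi>)
  qed
  have "bij_betw (subst \<sigma>) (forms n 1) (forms n 1)"
  proof (rule bij_betw_byWitness[where f' = "subst \<tau>"])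
    show "\<forall>p\<in>forms n 1. subst \<tau> (subst \<sigma> p) = p"
      by (intro ballI, subst subst_linear_form[where \<sigma> = \<sigma>])
        (simp_all only: subst_sum subst_scale \<tau>\<sigma>, rule linear_form_expand[symmetric])
    show "\<forall>p\<in>forms n 1. subst \<sigma> (subst \<tau> p) = p"
      by (intro ballI, subst subst_linear_form[where \<sigma> = \<tau>])
        (simp_all only: subst_sum subst_scale \<sigma>\<tau>, rule linear_form_expand[symmetric])
  qed (use \<sigma>maps \<tau>maps in auto)
  with \<sigma>L show ?thesis unfolding adapted_coords_def by blast
qed

end

theory Submission
  imports Defs
begin

text \<open>
  Fix a nonzero linear form \<open>L\<close> and coordinates \<open>\<sigma>\<close> in which \<open>L = y\<^sub>0\<close>.  Dehomogenization is then a
  surjective ring homomorphism \<open>S \<rightarrow> K[x\<^sub>1,\<dots>,x\<^sub>n]\<close> that sends \<open>L\<close> to \<open>1\<close> and is injective on forms of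
  a given degree.  Powers of \<open>L\<close> are thus exactly what it forgets: for a form \<open>b\<close> and an ideal \<open>J\<close>
  generated by forms, \<open>b\<^sub>*\<close> lies in \<open>J\<^sub>*\<close> if and only if some \<open>L\<^sup>t b\<close> lies in \<open>J\<close>
  (\<open>dehom_mem_Idl_iff\<close>).

  Saturation is controlled by the same condition.  By the pigeonhole principle, \<open>f\<close> is in the
  saturation of \<open>J\<close> if and only if every linear form has a power that multiplies \<open>f\<close> into \<open>J\<close>
  (\<open>saturation_iff_annihilating_forms\<close>).  Hence an ideal and its saturation have the same
  dehomogenization.  Since discarding \<open>c\<^sub>1,\<dots>,c\<^sub>k\<close> does not change the saturation, \<open>b\<^sub>1\<^sub>*,\<dots>,b\<^sub>h\<^sub>*\<close>
  generate \<open>I\<^sub>*\<close>.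

  For the second claim let \<open>J\<^sub>i\<close> be generated by the \<open>b\<^sub>j\<close> with \<open>j \<noteq> i\<close>, and let \<open>V\<^sub>i\<close> consist of the
  linear forms \<open>L\<close> such that \<open>L\<^sup>t b\<^sub>i \<in> J\<^sub>i\<close> for some \<open>t\<close>.  It is the linear part of the radical of
  the ideal quotient \<open>J\<^sub>i : b\<^sub>i\<close>, hence a subspace.  By the first paragraph, \<open>b\<^sub>i\<^sub>*\<close> is redundant for
  \<open>L\<close> exactly if \<open>L \<in> V\<^sub>i\<close>; and \<open>V\<^sub>i\<close> is proper, because otherwise \<open>b\<^sub>i\<close> would be in the saturation of
  \<open>J\<^sub>i\<close> and could be added to the maximal inessential set \<open>T\<close>.  So the subspaces \<open>V\<^sub>1,\<dots>,V\<^sub>h\<close> do what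
  is required.

  One point is hidden by the notation: \<open>{b\<^sub>1\<^sub>*,\<dots>,b\<^sub>h\<^sub>*}\<close> is a set, so an element might be redundant in
  the list without being so in the set if two \<open>b\<^sub>i\<^sub>*\<close> coincided.  They do not: coincidence means that
  \<open>b\<^sub>j = L\<^sup>e b\<^sub>i\<close>, up to exchanging \<open>i\<close> and \<open>j\<close>, and no element of a standard basis is a multiple of
  another one in this way (\<open>dehom_inj_on_standard_basis\<close>).
\<close>


section \<open>Subrings and ideals of polynomials\<close>

lemma polys_0 [simp]: "0 \<in> polys V"
  by (simp add: polys_def)

lemma polys_const [simp]: "const c \<in> polys V"
  by (simp add: polys_def const_def)

lemma const_1 [simp]: "const 1 = 1"
  by (simp add: const_def)

lemma polys_1 [simp]: "1 \<in> polys V"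
  using polys_const[of 1 V] by simp

lemma polys_var: "i \<in> V \<Longrightarrow> var i \<in> polys V"
  by (auto simp: polys_def var_def)

lemma polys_power: "p \<in> polys V \<Longrightarrow> p ^ k \<in> polys V"
  by (induction k) (auto intro: polys_mult)

lemma polys_prod: "(\<And>i. i \<in> A \<Longrightarrow> f i \<in> polys V) \<Longrightarrow> prod f A \<in> polys V"
  by (induction A rule: infinite_finite_induct) (auto intro: polys_mult)

lemma polys_sum: "(\<And>i. i \<in> A \<Longrightarrow> f i \<in> polys V) \<Longrightarrow> sum f A \<in> polys V"
  by (induction A rule: infinite_finite_induct) (auto intro: polys_add)

lemma forms_polys: "f \<in> forms n d \<Longrightarrow> f \<in> polys {0..n}"
  by (simp add: forms_def)

lemma ideal_poly_ringI:
  fixes A :: "'k::comm_ring_1 mpoly set"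
  assumes sub: "A \<subseteq> polys V" and zero: "0 \<in> A"
    and add: "\<And>a b. a \<in> A \<Longrightarrow> b \<in> A \<Longrightarrow> a + b \<in> A"
    and mult: "\<And>r a. r \<in> polys V \<Longrightarrow> a \<in> A \<Longrightarrow> r * a \<in> A"
  shows "ideal A (poly_ring V)"
proof -
  interpret R: cring "poly_ring V :: 'k mpoly ring" by (rule cring_poly_ring)
  have um: "- a \<in> A" if "a \<in> A" for a
    using mult[of "- 1" a] that by (simp add: polys_uminus)
  have mult': "a * r \<in> A" if "a \<in> A" "r \<in> polys V" for a r
    using mult[OF that(2,1)] by (simp add: mult.commute)
  have inv: "inv\<^bsub>add_monoid (poly_ring V)\<^esub> a = - a" if "a \<in> polys V" for a :: "'k mpoly"
  proof (rule group.inv_equality[OF R.a_group])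
    show "- a \<otimes>\<^bsub>add_monoid (poly_ring V)\<^esub> a = \<one>\<^bsub>add_monoid (poly_ring V)\<^esub>"
      by (simp add: poly_ring_def)
  qed (use that in \<open>simp_all add: poly_ring_def polys_uminus\<close>)
  show ?thesis
  proof (rule idealI)
    show "subgroup A (add_monoid (poly_ring V))"
    proof (rule group.subgroupI[OF R.a_group])
      fix a assume "a \<in> A"
      then show "inv\<^bsub>add_monoid (poly_ring V)\<^esub> a \<in> A"
        using inv[of a] um[of a] sub by auto
    qed (use sub zero add in \<open>auto simp: poly_ring_def\<close>)
  qed (use mult mult' R.ring_axioms in \<open>auto simp: poly_ring_def\<close>)
qed

lemma
  assumes "ideal A (poly_ring V :: 'k::comm_ring_1 mpoly ring)"
  shows ideal_polys: "A \<subseteq> polys V"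
    and ideal_0: "0 \<in> A"
    and ideal_add: "a \<in> A \<Longrightarrow> b \<in> A \<Longrightarrow> a + b \<in> A"
    and ideal_mult: "r \<in> polys V \<Longrightarrow> a \<in> A \<Longrightarrow> r * a \<in> A"
proof -
  interpret A: ideal A "poly_ring V" by fact
  show "A \<subseteq> polys V" "0 \<in> A" "a \<in> A \<Longrightarrow> b \<in> A \<Longrightarrow> a + b \<in> A"
    "r \<in> polys V \<Longrightarrow> a \<in> A \<Longrightarrow> r * a \<in> A"
    using A.a_subset A.I_l_closed[of a r] additive_subgroup.zero_closed[OF A.is_additive_subgroup]
      additive_subgroup.a_closed[OF A.is_additive_subgroup, of a b]
    by (simp_all add: poly_ring_def)
qed

lemma ideal_sum:
  "ideal A (poly_ring V) \<Longrightarrow> (\<And>i. i \<in> B \<Longrightarrow> f i \<in> A) \<Longrightarrow> sum f B \<in> A"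
  by (induction B rule: infinite_finite_induct) (auto intro: ideal_0 ideal_add)

lemma ideal_Idl: "G \<subseteq> polys V \<Longrightarrow> ideal (Idl\<^bsub>poly_ring V\<^esub> G) (poly_ring V)"
  using ring.genideal_ideal[OF cring.axioms(1)[OF cring_poly_ring], of G V]
  by (simp add: poly_ring_def)

lemma Idl_superset: "G \<subseteq> polys V \<Longrightarrow> G \<subseteq> Idl\<^bsub>poly_ring V\<^esub> G"
  using ring.genideal_self[OF cring.axioms(1)[OF cring_poly_ring], of G V]
  by (simp add: poly_ring_def)

lemma Idl_minimal: "ideal A (poly_ring V) \<Longrightarrow> G \<subseteq> A \<Longrightarrow> Idl\<^bsub>poly_ring V\<^esub> G \<subseteq> A"
  by (rule ring.genideal_minimal[OF cring.axioms(1)[OF cring_poly_ring]])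

lemma Idl_mono: "G \<subseteq> H \<Longrightarrow> H \<subseteq> polys V \<Longrightarrow> Idl\<^bsub>poly_ring V\<^esub> G \<subseteq> Idl\<^bsub>poly_ring V\<^esub> H"
  using Idl_superset[of H V] by (intro Idl_minimal ideal_Idl) auto


section \<open>Substitution as a ring homomorphism\<close>

definition subst_monom :: "(nat \<Rightarrow> 'k::comm_ring_1 mpoly) \<Rightarrow> (nat \<Rightarrow>\<^sub>0 nat) \<Rightarrow> 'k mpoly"
  where "subst_monom \<sigma> m = (\<Prod>i\<in>Poly_Mapping.keys m. \<sigma> i ^ Poly_Mapping.lookup m i)"

lemma subst_eq_sum:
  "subst \<sigma> p = (\<Sum>m\<in>Poly_Mapping.keys p. const (Poly_Mapping.lookup p m) * subst_monom \<sigma> m)"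
  by (simp add: subst_def subst_monom_def)

lemma subst_single: "subst \<sigma> (Poly_Mapping.single m c) = const c * subst_monom \<sigma> m"
  by (cases "c = 0") (simp_all add: subst_eq_sum const_def)

lemma subst_monom_superset:
  assumes "finite A" "Poly_Mapping.keys m \<subseteq> A"
  shows "subst_monom \<sigma> m = (\<Prod>i\<in>A. \<sigma> i ^ Poly_Mapping.lookup m i)"
  unfolding subst_monom_def using assms
  by (intro prod.mono_neutral_left) (auto simp: in_keys_iff)

lemma subst_monom_add: "subst_monom \<sigma> (m + m') = subst_monom \<sigma> m * subst_monom \<sigma> m'"
proof -
  let ?A = "Poly_Mapping.keys m \<union> Poly_Mapping.keys m'"
  have *: "finite ?A" by simp
  show ?thesis
    unfolding subst_monom_superset[OF * keys_add] subst_monom_superset[OF * Un_upper1]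
      subst_monom_superset[OF * Un_upper2]
    by (simp add: lookup_add power_add prod.distrib)
qed

lemma mpoly_eq_sum_single:
  fixes p :: "'k::comm_ring_1 mpoly"
  shows "p = (\<Sum>m\<in>Poly_Mapping.keys p. Poly_Mapping.single m (Poly_Mapping.lookup p m))"
proof (rule poly_mapping_eqI)
  fix m
  show "Poly_Mapping.lookup p m = Poly_Mapping.lookup
      (\<Sum>m\<in>Poly_Mapping.keys p. Poly_Mapping.single m (Poly_Mapping.lookup p m)) m"
    by (simp add: lookup_sum lookup_single when_def sum.delta in_keys_iff)
qed

lemma const_mult: "const (c * d) = const c * const d"
  by (simp add: const_def mult_single)

lemma subst_mult: "subst \<sigma> (p * q) = subst \<sigma> p * subst \<sigma> q"
proof -
  have *: "subst \<sigma> (Poly_Mapping.single m c * Poly_Mapping.single m' d) =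
      subst \<sigma> (Poly_Mapping.single m c) * subst \<sigma> (Poly_Mapping.single m' d)" for m c m' d
    by (simp add: mult_single subst_single subst_monom_add const_mult ac_simps)
  have "subst \<sigma> (p * q) = subst \<sigma>
      ((\<Sum>m\<in>Poly_Mapping.keys p. Poly_Mapping.single m (Poly_Mapping.lookup p m)) *
       (\<Sum>m\<in>Poly_Mapping.keys q. Poly_Mapping.single m (Poly_Mapping.lookup q m)))"
    by (simp flip: mpoly_eq_sum_single)
  also have "\<dots> =
      subst \<sigma> (\<Sum>m\<in>Poly_Mapping.keys p. Poly_Mapping.single m (Poly_Mapping.lookup p m)) *
      subst \<sigma> (\<Sum>m\<in>Poly_Mapping.keys q. Poly_Mapping.single m (Poly_Mapping.lookup q m))"
    by (simp add: sum_product subst_sum *)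
  finally show ?thesis by (simp flip: mpoly_eq_sum_single)
qed

lemma subst_0 [simp]: "subst \<sigma> 0 = 0"
  by (simp add: subst_def)

lemma subst_const [simp]: "subst \<sigma> (const c) = const c"
  unfolding const_def subst_single by (simp add: subst_monom_def const_def)

lemma subst_1 [simp]: "subst \<sigma> 1 = 1"
  using subst_const[of \<sigma> 1] by simp

lemma var_power: "var i ^ k = Poly_Mapping.single (Poly_Mapping.single i k) 1"
  by (induction k) (simp_all add: var_def mult_single flip: single_add)

lemma subst_monom_var:
  "subst_monom var m = (Poly_Mapping.single m 1 :: 'k::comm_ring_1 mpoly)"
proof -
  have pr: "(\<Prod>i\<in>A. Poly_Mapping.single (f i) (1::'k)) = Poly_Mapping.single (sum f A) 1"
    if "finite A" for A :: "nat set" and f :: "nat \<Rightarrow> nat \<Rightarrow>\<^sub>0 nat"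
    using that by induction (simp_all add: mult_single)
  have "m = (\<Sum>i\<in>Poly_Mapping.keys m. Poly_Mapping.single i (Poly_Mapping.lookup m i))"
    by (rule poly_mapping_eqI)
      (simp add: lookup_sum lookup_single when_def sum.delta in_keys_iff)
  then show ?thesis by (simp add: subst_monom_def var_power pr)
qed

text \<open>
  \<open>K[V]\<close> is generated as a ring by the constants and the variables in \<open>V\<close>; by this rule,
  substitutions need to be compared on variables only.
\<close>

lemma polys_induct [consumes 1, case_names const var add mult]:
  assumes p: "p \<in> polys V"
    and const: "\<And>c. P (const c)" and var: "\<And>i. i \<in> V \<Longrightarrow> P (var i)"
    and add: "\<And>p q. p \<in> polys V \<Longrightarrow> q \<in> polys V \<Longrightarrow> P p \<Longrightarrow> P q \<Longrightarrow> P (p + q)"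
    and mult: "\<And>p q. p \<in> polys V \<Longrightarrow> q \<in> polys V \<Longrightarrow> P p \<Longrightarrow> P q \<Longrightarrow> P (p * q)"
  shows "P p"
proof -
  have one: "P 1" and zero: "P 0"
    using const[of 1] const[of 0] by (simp_all add: const_def)
  have pow: "P (var i ^ k)" if "i \<in> V" for i k
    using that by (induction k) (auto intro: mult var one polys_var polys_power)
  have pr: "P (\<Prod>i\<in>A. var i ^ f i)" if "A \<subseteq> V" for A f
    using that by (induction A rule: infinite_finite_induct)
      (auto intro!: mult pow one polys_var polys_power polys_prod)
  have monom: "P (Poly_Mapping.single m c)" and monom_polys: "Poly_Mapping.single m c \<in> polys V"
    if "Poly_Mapping.keys m \<subseteq> V" for m c
  proof -
    have "P (const c * (\<Prod>i\<in>Poly_Mapping.keys m. var i ^ Poly_Mapping.lookup m i))"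
      using that by (intro mult const pr polys_prod polys_power polys_var polys_const) auto
    moreover have "(\<Prod>i\<in>Poly_Mapping.keys m. var i ^ Poly_Mapping.lookup m i) =
        Poly_Mapping.single m (1::'a)"
      using subst_monom_var[of m] by (simp add: subst_monom_def)
    ultimately show "P (Poly_Mapping.single m c)"
      by (simp add: const_def mult_single)
    show "Poly_Mapping.single m c \<in> polys V"
      using that by (simp add: polys_def)
  qed
  have "P (\<Sum>m\<in>A. Poly_Mapping.single m (Poly_Mapping.lookup p m))"
    if "A \<subseteq> Poly_Mapping.keys p" for A
    using that
  proof (induction A rule: infinite_finite_induct)
    case (insert m A)
    have "Poly_Mapping.keys k \<subseteq> V" if "k \<in> insert m A" for k
      using that insert.prems p unfolding polys_def by blast
    then show ?case
      using insert by (auto intro!: add monom monom_polys polys_sum)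
  qed (auto intro: zero)
  from this[OF order.refl] show ?thesis by (simp flip: mpoly_eq_sum_single)
qed

lemma subst_polys:
  assumes "p \<in> polys V" "\<And>i. i \<in> V \<Longrightarrow> \<sigma> i \<in> polys W"
  shows "subst \<sigma> p \<in> polys W"
  using assms(1) by (induction rule: polys_induct)
    (auto simp: subst_var subst_add subst_mult assms(2) intro: polys_add polys_mult)

lemma subst_subst_id:
  assumes "p \<in> polys V" "\<And>i. i \<in> V \<Longrightarrow> subst \<tau> (\<sigma> i) = var i"
  shows "subst \<tau> (subst \<sigma> p) = p"
  using assms(1) by (induction rule: polys_induct)
    (auto simp: subst_var subst_add subst_mult assms(2))

lemma subst_id:
  assumes "p \<in> polys V" "\<And>i. i \<in> V \<Longrightarrow> \<sigma> i = var i"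
  shows "subst \<sigma> p = p"
  using assms(1) by (induction rule: polys_induct)
    (auto simp: subst_var subst_add subst_mult assms(2))


section \<open>Forms\<close>

lemma mdeg_superset:
  assumes "finite A" "Poly_Mapping.keys m \<subseteq> A"
  shows "mdeg m = (\<Sum>i\<in>A. Poly_Mapping.lookup m i)"
  unfolding mdeg_def using assms
  by (intro sum.mono_neutral_left) (auto simp: in_keys_iff)

lemma mdeg_add: "mdeg (m + m') = mdeg m + mdeg m'"
proof -
  let ?A = "Poly_Mapping.keys m \<union> Poly_Mapping.keys m'"
  have *: "finite ?A" by simp
  show ?thesis
    unfolding mdeg_superset[OF * keys_add] mdeg_superset[OF * Un_upper1]
      mdeg_superset[OF * Un_upper2]
    by (simp add: lookup_add sum.distrib)
qed

lemma forms_0 [simp]: "0 \<in> forms n d"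
  by (simp add: forms_def)

lemma forms_const: "const c \<in> forms n 0"
  by (auto simp: forms_def const_def mdeg_def polys_def)

lemma forms_1: "1 \<in> forms n 0"
  using forms_const[of 1] by simp

lemma forms_mult:
  assumes "p \<in> forms n d" "q \<in> forms n e"
  shows "p * q \<in> forms n (d + e)"
proof -
  have "mdeg m = d + e" if "m \<in> Poly_Mapping.keys (p * q)" for m
  proof -
    from that obtain a b
      where "m = a + b" "a \<in> Poly_Mapping.keys p" "b \<in> Poly_Mapping.keys q"
      using keys_mult[of p q] by blast
    then show ?thesis using assms by (simp add: mdeg_add forms_def)
  qed
  then show ?thesis using assms by (simp add: forms_def polys_mult)
qed

lemma forms_power: "p \<in> forms n d \<Longrightarrow> p ^ k \<in> forms n (k * d)"
  by (induction k) (auto intro: forms_1 forms_mult)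

lemma forms_prod:
  "(\<And>i. i \<in> A \<Longrightarrow> f i \<in> forms n (d i)) \<Longrightarrow> prod f A \<in> forms n (sum d A)"
  by (induction A rule: infinite_finite_induct) (auto intro: forms_1 forms_mult)

lemma subst_forms:
  assumes p: "p \<in> forms n d" and \<sigma>: "\<And>i. i \<le> n \<Longrightarrow> \<sigma> i \<in> forms n 1"
  shows "subst \<sigma> p \<in> forms n d"
  unfolding subst_eq_sum
proof (rule forms_sum)
  fix m assume m: "m \<in> Poly_Mapping.keys p"
  have V: "Poly_Mapping.keys m \<subseteq> {0..n}" and d: "mdeg m = d"
    using m p by (auto simp: forms_def polys_def)
  have "subst_monom \<sigma> m \<in> forms n (\<Sum>i\<in>Poly_Mapping.keys m. Poly_Mapping.lookup m i * 1)"
    unfolding subst_monom_def using V by (intro forms_prod forms_power \<sigma>) auto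
  then have "subst_monom \<sigma> m \<in> forms n d" by (simp add: mdeg_def flip: d)
  from forms_mult[OF forms_const this]
  show "const (Poly_Mapping.lookup p m) * subst_monom \<sigma> m \<in> forms n d" by simp
qed

abbreviation set_var0_to_1 :: "nat \<Rightarrow> 'k::comm_ring_1 mpoly"
  where "set_var0_to_1 \<equiv> \<lambda>i. if i = 0 then 1 else var i"

text \<open>
  Setting \<open>y\<^sub>0 = 1\<close> deletes \<open>y\<^sub>0\<close> from a power product; if the total degree is known, then the
  lost exponent of \<open>y\<^sub>0\<close> can be recovered, so distinct power products of the same degree do not
  collide.
\<close>

lemma set_var0_to_1_forms_eq_0:
  fixes f :: "'k::comm_ring_1 mpoly"
  assumes f: "f \<in> forms n d" and z: "subst set_var0_to_1 f = 0"
  shows "f = 0"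
proof -
  define red :: "(nat \<Rightarrow>\<^sub>0 nat) \<Rightarrow> (nat \<Rightarrow>\<^sub>0 nat)"
    where "red m = m - Poly_Mapping.single 0 (Poly_Mapping.lookup m 0)" for m
  have split: "m = red m + Poly_Mapping.single 0 (Poly_Mapping.lookup m 0)" for m
    by (rule poly_mapping_eqI)
      (simp add: red_def lookup_add lookup_minus lookup_single when_def)
  have red0: "0 \<notin> Poly_Mapping.keys (red m)" for m
    by (simp add: red_def in_keys_iff lookup_minus)
  have monom: "subst_monom set_var0_to_1 m = Poly_Mapping.single (red m) (1::'k)" for m
  proof -
    have "subst_monom set_var0_to_1 (red m) = (subst_monom var (red m) :: 'k mpoly)"
      unfolding subst_monom_def using red0[of m] by (intro prod.cong) auto
    moreover have "subst_monom set_var0_to_1 (Poly_Mapping.single 0 k) = (1 :: 'k mpoly)" for k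
      by (simp add: subst_monom_def)
    ultimately show ?thesis
      by (subst split) (simp add: subst_monom_add subst_monom_var)
  qed
  have inj: "m = m'" if "m \<in> Poly_Mapping.keys f" "m' \<in> Poly_Mapping.keys f" "red m = red m'"
    for m m'
  proof -
    have sd: "mdeg k = mdeg (red k) + Poly_Mapping.lookup k 0" for k
      by (subst split, simp only: mdeg_add) (simp add: mdeg_def)
    have "mdeg m = mdeg m'" using that f by (simp add: forms_def)
    then have "Poly_Mapping.lookup m 0 = Poly_Mapping.lookup m' 0"
      using sd[of m] sd[of m'] that(3) by simp
    then show ?thesis using split[of m] split[of m'] that(3) by metis
  qed
  have "Poly_Mapping.lookup f m = 0" if m: "m \<in> Poly_Mapping.keys f" for m
  proof -
    have "0 = Poly_Mapping.lookup (subst set_var0_to_1 f) (red m)" using z by simp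
    \<comment> \<open>No other term of \<open>f\<close> contributes to the coefficient at the reduced power product of \<open>m\<close>.\<close>
    also have "\<dots> = (\<Sum>k\<in>Poly_Mapping.keys f. if k = m then Poly_Mapping.lookup f k else 0)"
      unfolding subst_eq_sum monom lookup_sum
      by (intro sum.cong) (auto simp: const_def mult_single lookup_single when_def dest: inj[OF _ m])
    also have "\<dots> = Poly_Mapping.lookup f m" using m by (simp add: sum.delta)
    finally show ?thesis by simp
  qed
  then show ?thesis by (metis in_keys_iff keys_eq_empty equals0I)
qed


section \<open>Dehomogenization\<close>

lemma dehom_add: "dehom \<sigma> (p + q) = dehom \<sigma> p + dehom \<sigma> q"
  and dehom_mult: "dehom \<sigma> (p * q) = dehom \<sigma> p * dehom \<sigma> q"
  and dehom_0 [simp]: "dehom \<sigma> 0 = 0"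
  and dehom_1 [simp]: "dehom \<sigma> 1 = 1"
  by (simp_all add: dehom_def subst_add subst_mult)

lemma dehom_power: "dehom \<sigma> (p ^ k) = dehom \<sigma> p ^ k"
  by (induction k) (simp_all add: dehom_mult)

context
  fixes n :: nat and L :: "'k::comm_ring_1 mpoly" and \<sigma> :: "nat \<Rightarrow> 'k mpoly"
  assumes L: "L \<in> forms n 1" and adapted: "adapted_coords n L \<sigma>"
begin

lemma dehom_adapted_form [simp]: "dehom \<sigma> L = 1"
  using adapted by (simp add: adapted_coords_def dehom_def subst_var)

lemma dehom_adapted_form_power_mult [simp]: "dehom \<sigma> (L ^ k * p) = dehom \<sigma> p"
  by (simp add: dehom_mult dehom_power)

lemma adapted_coords_forms: "i \<le> n \<Longrightarrow> \<sigma> i \<in> forms n 1"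
  using adapted bij_betwE[of "subst \<sigma>" "forms n 1" "forms n 1"] var_in_forms[of i n]
  by (auto simp: adapted_coords_def subst_var dest: bspec[of _ _ "var i"])

text \<open>
  Invertibility of the substitution on linear forms supplies the inverse coordinate change, and
  with it invertibility on all polynomials.
\<close>

lemma adapted_coords_inverse:
  obtains \<tau> where "\<And>i. i \<le> n \<Longrightarrow> \<tau> i \<in> forms n 1"
    "\<And>i. i \<le> n \<Longrightarrow> subst \<sigma> (\<tau> i) = var i" "\<And>i. i \<le> n \<Longrightarrow> subst \<tau> (\<sigma> i) = var i"
proof -
  have bij: "bij_betw (subst \<sigma>) (forms n 1) (forms n 1)"
    using adapted by (simp add: adapted_coords_def)
  define \<tau> :: "nat \<Rightarrow> 'k mpoly" where "\<tau> i = inv_into (forms n 1) (subst \<sigma>) (var i)" for i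
  have \<tau>: "\<tau> i \<in> forms n 1" "subst \<sigma> (\<tau> i) = var i" if "i \<le> n" for i
    using bij_betw_imp_surj_on[OF bij] var_in_forms[OF that, where 'a = 'k]
    by (auto simp: \<tau>_def inv_into_into f_inv_into_f simp del: One_nat_def)
  moreover have "subst \<tau> (\<sigma> i) = var i" if i: "i \<le> n" for i
  proof (rule inj_onD[OF bij_betw_imp_inj_on[OF bij]])
    have "subst \<sigma> (subst \<tau> (\<sigma> i)) = \<sigma> i"
      by (rule subst_subst_id[OF forms_polys[OF adapted_coords_forms[OF i]]]) (simp add: \<tau>)
    then show "subst \<sigma> (subst \<tau> (\<sigma> i)) = subst \<sigma> (var i)" by (simp add: subst_var)
    show "subst \<tau> (\<sigma> i) \<in> forms n 1"
      by (rule subst_forms[OF adapted_coords_forms[OF i]]) (rule \<tau>)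
  qed (rule var_in_forms[OF i])
  ultimately show thesis using that by blast
qed

lemma dehom_polys: "p \<in> polys {0..n} \<Longrightarrow> dehom \<sigma> p \<in> polys {1..n}"
  unfolding dehom_def
  by (rule subst_polys[where V = "{0..n}"], rule subst_polys[where V = "{0..n}"])
    (auto intro: polys_var forms_polys adapted_coords_forms)

text \<open>
  A preimage is found by moving \<open>q\<close> back to the old coordinates; setting \<open>y\<^sub>0 = 1\<close> afterwards
  does not affect \<open>q\<close>, since \<open>y\<^sub>0\<close> does not occur in it.
\<close>

lemma dehom_surj:
  assumes "q \<in> polys {1..n}"
  obtains p where "p \<in> polys {0..n}" "dehom \<sigma> p = q"
proof -
  obtain \<tau> where \<tau>: "\<And>i. i \<le> n \<Longrightarrow> \<tau> i \<in> forms n 1" "\<And>i. i \<le> n \<Longrightarrow> subst \<sigma> (\<tau> i) = var i"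
    by (rule adapted_coords_inverse) blast
  have "subst \<sigma> (subst \<tau> q) = q"
    by (rule subst_subst_id[OF assms]) (simp add: \<tau>)
  then have "dehom \<sigma> (subst \<tau> q) = q"
    using subst_id[OF assms, of set_var0_to_1] by (simp add: dehom_def)
  moreover have "subst \<tau> q \<in> polys {0..n}"
    by (rule subst_polys[OF assms]) (simp add: forms_polys[OF \<tau>(1)])
  ultimately show thesis using that by blast
qed

lemma dehom_inj_on_forms: "inj_on (dehom \<sigma>) (forms n d)"
proof (rule inj_onI)
  fix f g assume f: "f \<in> forms n d" and g: "g \<in> forms n d" and eq: "dehom \<sigma> f = dehom \<sigma> g"
  obtain \<tau> where \<tau>: "\<And>i. i \<le> n \<Longrightarrow> subst \<tau> (\<sigma> i) = var i"
    by (rule adapted_coords_inverse) blast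
  have fg: "f - g \<in> forms n d" using f g by (rule forms_diff)
  have "subst \<sigma> (f - g) = 0"
    by (rule set_var0_to_1_forms_eq_0[OF subst_forms[OF fg adapted_coords_forms]])
      (use eq in \<open>simp_all add: dehom_def subst_diff\<close>)
  moreover have "subst \<tau> (subst \<sigma> (f - g)) = f - g"
    by (rule subst_subst_id[OF forms_polys[OF fg]]) (simp add: \<tau>)
  ultimately show "f = g" by simp
qed

lemma dehom_image_Idl:
  assumes G: "G \<subseteq> polys {0..n}"
  shows "dehom \<sigma> ` (Idl\<^bsub>S_ring n\<^esub> G) = Idl\<^bsub>affine_ring n\<^esub> (dehom \<sigma> ` G)"
proof
  have G': "dehom \<sigma> ` G \<subseteq> polys {1..n}" using G dehom_polys by blast
  note J = ideal_Idl[OF G] and J' = ideal_Idl[OF G']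
  have "ideal {p \<in> polys {0..n}. dehom \<sigma> p \<in> Idl\<^bsub>affine_ring n\<^esub> (dehom \<sigma> ` G)} (S_ring n)"
    by (rule ideal_poly_ringI)
      (auto simp: dehom_add dehom_mult simp del: One_nat_def
        intro: polys_add polys_mult ideal_0[OF J']
        ideal_add[OF J'] ideal_mult[OF J'] dehom_polys)
  then have "Idl\<^bsub>S_ring n\<^esub> G \<subseteq> {p \<in> polys {0..n}. dehom \<sigma> p \<in> Idl\<^bsub>affine_ring n\<^esub> (dehom \<sigma> ` G)}"
    using G Idl_superset[OF G'] by (intro Idl_minimal) auto
  then show "dehom \<sigma> ` (Idl\<^bsub>S_ring n\<^esub> G) \<subseteq> Idl\<^bsub>affine_ring n\<^esub> (dehom \<sigma> ` G)" by blast
  have "ideal (dehom \<sigma> ` (Idl\<^bsub>S_ring n\<^esub> G)) (affine_ring n)"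
  proof (rule ideal_poly_ringI)
    show "dehom \<sigma> ` (Idl\<^bsub>S_ring n\<^esub> G) \<subseteq> polys {1..n}"
      using ideal_polys[OF J] dehom_polys by blast
    show "0 \<in> dehom \<sigma> ` (Idl\<^bsub>S_ring n\<^esub> G)"
      using ideal_0[OF J] by (intro image_eqI[where x = 0]) auto
  next
    fix a b assume "a \<in> dehom \<sigma> ` (Idl\<^bsub>S_ring n\<^esub> G)" "b \<in> dehom \<sigma> ` (Idl\<^bsub>S_ring n\<^esub> G)"
    then show "a + b \<in> dehom \<sigma> ` (Idl\<^bsub>S_ring n\<^esub> G)"
      using ideal_add[OF J] by (auto simp flip: dehom_add)
  next
    fix r a :: "'k mpoly" assume "r \<in> polys {1..n}" "a \<in> dehom \<sigma> ` (Idl\<^bsub>S_ring n\<^esub> G)"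
    then show "r * a \<in> dehom \<sigma> ` (Idl\<^bsub>S_ring n\<^esub> G)"
      
      using ideal_mult[OF J] by (auto elim!: dehom_surj[of r] simp del: One_nat_def simp flip: dehom_mult)
  qed
  then show "Idl\<^bsub>affine_ring n\<^esub> (dehom \<sigma> ` G) \<subseteq> dehom \<sigma> ` (Idl\<^bsub>S_ring n\<^esub> G)"
    using Idl_superset[OF G] by (intro Idl_minimal) auto
qed

text \<open>
  Homogenization, without reference to homogeneous components: each constant or variable can be
  brought to any larger degree by multiplying it with a power of \<open>L\<close>, which dehomogenization does
  not see.  The statement asks for all large degrees rather than for one because summands have to
  be brought to a common degree.
\<close>

lemma dehom_eq_dehom_form:
  assumes "p \<in> polys {0..n}"
  shows "\<exists>N\<^sub>0. \<forall>N\<ge>N\<^sub>0. \<exists>q\<in>forms n N. dehom \<sigma> q = dehom \<sigma> p"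
  using assms
proof (induction rule: polys_induct)
  case (const c)
  have "L ^ N * const c \<in> forms n N" for N
    using forms_mult[OF forms_power[OF L, of N] forms_const[of c n]] by simp
  then show ?case by (metis dehom_adapted_form_power_mult)
next
  case (var i)
  have "L ^ (N - 1) * var i \<in> forms n N" if "N \<ge> 1" for N
    using forms_mult[OF forms_power[OF L, of "N - 1"] var_in_forms[of i n]] var that by simp
  then show ?case by (metis dehom_adapted_form_power_mult)
next
  case (add p q)
  then obtain M N where
    M: "\<forall>k\<ge>M. \<exists>p'\<in>forms n k. dehom \<sigma> p' = dehom \<sigma> p" and
    N: "\<forall>k\<ge>N. \<exists>q'\<in>forms n k. dehom \<sigma> q' = dehom \<sigma> q" by blast
  have "\<exists>r\<in>forms n k. dehom \<sigma> r = dehom \<sigma> (p + q)" if "k \<ge> max M N" for k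
    using M[rule_format, of k] N[rule_format, of k] that
    by (metis dehom_add forms_add max.bounded_iff)
  then show ?case by blast
next
  case (mult p q)
  then obtain M N where
    M: "\<forall>k\<ge>M. \<exists>p'\<in>forms n k. dehom \<sigma> p' = dehom \<sigma> p" and
    N: "\<forall>k\<ge>N. \<exists>q'\<in>forms n k. dehom \<sigma> q' = dehom \<sigma> q" by blast
  have "\<exists>r\<in>forms n k. dehom \<sigma> r = dehom \<sigma> (p * q)" if k: "k \<ge> M + N" for k
  proof -
    have le: "N \<le> k - M" using k by auto
    obtain p' q' where "p' \<in> forms n M" "dehom \<sigma> p' = dehom \<sigma> p"
      "q' \<in> forms n (k - M)" "dehom \<sigma> q' = dehom \<sigma> q"
      using M[rule_format, of M] N[rule_format, of "k - M"] le by auto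
    then show ?thesis
      using forms_mult[of p' n M q' "k - M"] k by (intro bexI[of _ "p' * q'"]) (auto simp: dehom_mult)
  qed
  then show ?case by blast
qed

text \<open>
  The elements that can be homogenized inside the ideal form themselves an ideal, by the previous
  lemma for the factor from \<open>S\<close>, and this ideal contains the given generators.
\<close>

lemma dehom_Idl_eq_dehom_form:
  assumes G: "G \<subseteq> (\<Union>d. forms n d)" and g: "g \<in> Idl\<^bsub>S_ring n\<^esub> G"
  shows "\<exists>N\<^sub>0. \<forall>N\<ge>N\<^sub>0. \<exists>h \<in> Idl\<^bsub>S_ring n\<^esub> G \<inter> forms n N. dehom \<sigma> h = dehom \<sigma> g"
proof -
  have GS: "G \<subseteq> polys {0..n}" using G by (auto simp: forms_def)
  note J = ideal_Idl[OF GS]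
  define A where "A = {g \<in> polys {0..n}.
    \<exists>N\<^sub>0. \<forall>N\<ge>N\<^sub>0. \<exists>h \<in> Idl\<^bsub>S_ring n\<^esub> G \<inter> forms n N. dehom \<sigma> h = dehom \<sigma> g}"
  have "ideal A (S_ring n)"
  proof (rule ideal_poly_ringI)
    show "A \<subseteq> polys {0..n}" by (auto simp: A_def)
    show "0 \<in> A" unfolding A_def using ideal_0[OF J] by (auto intro!: bexI[of _ 0])
  next
    fix p q assume "p \<in> A" "q \<in> A"
    then obtain M N where pq: "p \<in> polys {0..n}" "q \<in> polys {0..n}" and
      M: "\<forall>k\<ge>M. \<exists>p'\<in>Idl\<^bsub>S_ring n\<^esub> G \<inter> forms n k. dehom \<sigma> p' = dehom \<sigma> p" and
      N: "\<forall>k\<ge>N. \<exists>q'\<in>Idl\<^bsub>S_ring n\<^esub> G \<inter> forms n k. dehom \<sigma> q' = dehom \<sigma> q"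
      unfolding A_def by blast
    have "\<exists>r\<in>Idl\<^bsub>S_ring n\<^esub> G \<inter> forms n k. dehom \<sigma> r = dehom \<sigma> (p + q)" if k: "k \<ge> max M N" for k
    proof -
      obtain p' q' where "p' \<in> Idl\<^bsub>S_ring n\<^esub> G \<inter> forms n k" "dehom \<sigma> p' = dehom \<sigma> p"
        "q' \<in> Idl\<^bsub>S_ring n\<^esub> G \<inter> forms n k" "dehom \<sigma> q' = dehom \<sigma> q"
        using M[rule_format, of k] N[rule_format, of k] k by auto
      then show ?thesis
        by (intro bexI[of _ "p' + q'"]) (auto simp: dehom_add intro: ideal_add[OF J] forms_add)
    qed
    then show "p + q \<in> A" using pq unfolding A_def by (blast intro: polys_add)
  next
    fix r p :: "'k mpoly" assume r: "r \<in> polys {0..n}" and "p \<in> A"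
    then obtain N where p: "p \<in> polys {0..n}" and
      N: "\<forall>k\<ge>N. \<exists>p'\<in>Idl\<^bsub>S_ring n\<^esub> G \<inter> forms n k. dehom \<sigma> p' = dehom \<sigma> p"
      unfolding A_def by blast
    obtain M where M: "\<forall>k\<ge>M. \<exists>r'\<in>forms n k. dehom \<sigma> r' = dehom \<sigma> r"
      using dehom_eq_dehom_form[OF r] by blast
    have "\<exists>q\<in>Idl\<^bsub>S_ring n\<^esub> G \<inter> forms n k. dehom \<sigma> q = dehom \<sigma> (r * p)" if k: "k \<ge> M + N" for k
    proof -
      have le: "N \<le> k - M" using k by auto
      obtain r' p' where "r' \<in> forms n M" "dehom \<sigma> r' = dehom \<sigma> r"
        "p' \<in> Idl\<^bsub>S_ring n\<^esub> G \<inter> forms n (k - M)" "dehom \<sigma> p' = dehom \<sigma> p"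
        using M[rule_format, of M] N[rule_format, of "k - M"] le by auto
      then show ?thesis
        using forms_mult[of r' n M p' "k - M"] k
        by (intro bexI[of _ "r' * p'"]) (auto simp: dehom_mult intro: ideal_mult[OF J] forms_polys)
    qed
    then show "r * p \<in> A" using r p unfolding A_def by (blast intro: polys_mult)
  qed
  moreover have "G \<subseteq> A"
  proof
    fix g assume g: "g \<in> G"
    then obtain d where d: "g \<in> forms n d" using G by blast
    have "L ^ (N - d) * g \<in> Idl\<^bsub>S_ring n\<^esub> G \<inter> forms n N" if "N \<ge> d" for N
      using forms_mult[OF forms_power[OF L, of "N - d"] d] that g Idl_superset[OF GS]
      by (auto intro!: ideal_mult[OF J] polys_power forms_polys[OF L])
    then show "g \<in> A"
      using g GS unfolding A_def by (auto intro!: exI[of _ d] bexI[of _ "L ^ (_ - d) * g"])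
  qed
  ultimately have "Idl\<^bsub>S_ring n\<^esub> G \<subseteq> A" by (rule Idl_minimal)
  then show ?thesis using g unfolding A_def by blast
qed

text \<open>
  If \<open>b\<^sub>*\<close> is the image of an element of the ideal, homogenize that element to a form \<open>h\<close> of the
  ideal of large degree.  The forms \<open>L\<^sup>t b\<close> and \<open>h\<close> then agree after dehomogenization, and for the
  \<open>t\<close> that gives them equal degrees they must be equal.
\<close>

lemma dehom_mem_Idl_iff:
  assumes G: "G \<subseteq> (\<Union>d. forms n d)" and b: "b \<in> forms n d"
  shows "dehom \<sigma> b \<in> Idl\<^bsub>affine_ring n\<^esub> (dehom \<sigma> ` G) \<longleftrightarrow> (\<exists>t. L ^ t * b \<in> Idl\<^bsub>S_ring n\<^esub> G)"
proof -
  have GS: "G \<subseteq> polys {0..n}" using G by (auto simp: forms_def)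
  note image = dehom_image_Idl[OF GS, symmetric]
  show ?thesis
  proof
    assume "dehom \<sigma> b \<in> Idl\<^bsub>affine_ring n\<^esub> (dehom \<sigma> ` G)"
    then obtain g where g: "g \<in> Idl\<^bsub>S_ring n\<^esub> G" "dehom \<sigma> b = dehom \<sigma> g"
      unfolding image by blast
    obtain N\<^sub>0 where "\<forall>N\<ge>N\<^sub>0. \<exists>h \<in> Idl\<^bsub>S_ring n\<^esub> G \<inter> forms n N. dehom \<sigma> h = dehom \<sigma> g"
      using dehom_Idl_eq_dehom_form[OF G g(1)] by blast
    then obtain h where h: "h \<in> Idl\<^bsub>S_ring n\<^esub> G" "h \<in> forms n (N\<^sub>0 + d)" "dehom \<sigma> h = dehom \<sigma> g"
      using le_add1 by blast
    have "L ^ N\<^sub>0 * b = h"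
      by (rule inj_onD[OF dehom_inj_on_forms[of "N\<^sub>0 + d"]])
        (use h g forms_mult[OF forms_power[OF L, of N\<^sub>0] b] in simp_all)
    then show "\<exists>t. L ^ t * b \<in> Idl\<^bsub>S_ring n\<^esub> G" using h by blast
  next
    assume "\<exists>t. L ^ t * b \<in> Idl\<^bsub>S_ring n\<^esub> G"
    then show "dehom \<sigma> b \<in> Idl\<^bsub>affine_ring n\<^esub> (dehom \<sigma> ` G)"
      unfolding image by (metis dehom_adapted_form_power_mult imageI)
  qed
qed

end


section \<open>Saturation\<close>

lemma irrelevant_ideal_ideal: "ideal (irrelevant_ideal n) (S_ring n)"
  unfolding irrelevant_ideal_def by (intro ideal_Idl) (auto intro: polys_var)

lemma linear_form_in_irrelevant_ideal:
  assumes "L \<in> forms n 1"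
  shows "L \<in> irrelevant_ideal n"
proof -
  have "var ` {0..n} \<subseteq> irrelevant_ideal n"
    unfolding irrelevant_ideal_def by (intro Idl_superset) (auto intro: polys_var)
  then have "(\<Sum>i\<le>n. scale (Poly_Mapping.lookup L (Poly_Mapping.single i 1)) (var i))
      \<in> irrelevant_ideal n"
    unfolding scale_def
    by (intro ideal_sum[OF irrelevant_ideal_ideal] ideal_mult[OF irrelevant_ideal_ideal]) auto
  then show ?thesis using linear_form_expand[OF assms] by simp
qed

lemma irrelevant_ideal_power_0: "irrelevant_ideal n [^]\<^bsub>ideals_set (S_ring n)\<^esub> (0::nat) = polys {0..n}"
  by (simp add: nat_pow_def ideals_set_def poly_ring_def)

lemma irrelevant_ideal_power_Suc: "irrelevant_ideal n [^]\<^bsub>ideals_set (S_ring n)\<^esub> Suc t =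
    ideal_prod (S_ring n) (irrelevant_ideal n [^]\<^bsub>ideals_set (S_ring n)\<^esub> t) (irrelevant_ideal n)"
  by (simp add: nat_pow_def ideals_set_def)

lemma linear_form_power_in_irrelevant_ideal_power:
  assumes "L \<in> forms n 1"
  shows "L ^ t \<in> irrelevant_ideal n [^]\<^bsub>ideals_set (S_ring n)\<^esub> t"
proof (induction t)
  case 0
  show ?case unfolding irrelevant_ideal_power_0 by simp
next
  case (Suc t)
  show ?case
    unfolding irrelevant_ideal_power_Suc
    using ideal_prod.prod[OF Suc linear_form_in_irrelevant_ideal[OF assms], of "S_ring n"]
    by (simp add: poly_ring_def mult.commute)
qed

text \<open>
  Polynomials all of whose terms have degree at least \<open>s\<close> form an ideal \<open>A s\<close>, with
  \<open>A s \<cdot> A s' \<subseteq> A (s + s')\<close>, and the variables are in \<open>A 1\<close>.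
\<close>

lemma irrelevant_ideal_power_mdeg:
  fixes g :: "'k::comm_ring_1 mpoly"
  assumes "g \<in> irrelevant_ideal n [^]\<^bsub>ideals_set (S_ring n)\<^esub> t"
  shows "g \<in> polys {0..n} \<and> (\<forall>m\<in>Poly_Mapping.keys g. t \<le> mdeg m)"
  using assms
proof (induction t arbitrary: g)
  case 0
  then show ?case unfolding irrelevant_ideal_power_0 by simp
next
  case (Suc t)
  define A :: "nat \<Rightarrow> 'k mpoly set"
    where "A s = {g \<in> polys {0..n}. \<forall>m\<in>Poly_Mapping.keys g. s \<le> mdeg m}" for s
  have A_mult: "p * q \<in> A (s + s')" if "p \<in> A s" "q \<in> A s'" for p q s s'
  proof -
    have "s + s' \<le> mdeg m" if "m \<in> Poly_Mapping.keys (p * q)" for m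
    proof -
      from that obtain a b
        where "m = a + b" "a \<in> Poly_Mapping.keys p" "b \<in> Poly_Mapping.keys q"
        using keys_mult[of p q] by blast
      then show ?thesis using \<open>p \<in> A s\<close> \<open>q \<in> A s'\<close> by (auto simp: mdeg_add A_def intro: add_mono)
    qed
    then show ?thesis using that by (simp add: A_def polys_mult)
  qed
  have A_add: "p + q \<in> A s" if "p \<in> A s" "q \<in> A s" for p q s
    using that keys_add[of p q] by (auto simp: A_def polys_add)
  have "ideal (A 1) (S_ring n)"
  proof (rule ideal_poly_ringI)
    fix r p :: "'k mpoly" assume "r \<in> polys {0..n}" "p \<in> A 1"
    then show "r * p \<in> A 1" using A_mult[of r 0 p 1] by (simp add: A_def)
  next
    show "p + q \<in> A 1" if "p \<in> A 1" "q \<in> A 1" for p q using that by (rule A_add)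
  qed (auto simp: A_def)
  moreover have "var ` {0..n} \<subseteq> A 1"
    using var_in_forms[of _ n, where 'a = 'k] by (auto simp: A_def forms_def)
  ultimately have irr: "irrelevant_ideal n \<subseteq> A 1"
    unfolding irrelevant_ideal_def by (rule Idl_minimal)
  have "g \<in> ideal_prod (S_ring n) (irrelevant_ideal n [^]\<^bsub>ideals_set (S_ring n)\<^esub> t)
      (irrelevant_ideal n)"
    using Suc.prems unfolding irrelevant_ideal_power_Suc .
  then have "g \<in> A (Suc t)"
  proof induction
    case (prod p q)
    then have "p \<in> A t" "q \<in> A 1" using Suc.IH irr by (auto simp: A_def)
    then show ?case using A_mult[of p t q 1] by (simp add: poly_ring_def)
  next
    case (sum p q)
    then show ?case using A_add by (simp add: poly_ring_def)
  qed
  then show ?case by (simp add: A_def)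
qed

text \<open>
  The linear forms in the radical of the ideal quotient \<open>J : f\<close>.
\<close>

definition annihilating_forms :: "nat \<Rightarrow> 'k::comm_ring_1 mpoly set \<Rightarrow> 'k mpoly \<Rightarrow> 'k mpoly set"
  where "annihilating_forms n J f = {L \<in> forms n 1. \<exists>t. L ^ t * f \<in> J}"

lemma power_mult_mem_ideal_mono:
  assumes J: "ideal J (poly_ring V)" and "a \<in> polys V" and "a ^ s * f \<in> J" and "s \<le> t"
  shows "a ^ t * f \<in> J"
proof -
  have "a ^ (t - s) * (a ^ s * f) \<in> J" 
    by (rule ideal_mult[OF J polys_power[OF assms(2)] assms(3)])
  moreover have "a ^ (t - s) * a ^ s = a ^ t" using \<open>s \<le> t\<close> by (simp flip: power_add)
  ultimately show ?thesis by (metis mult.assoc)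
qed

text \<open>
  For sums, every term of the binomial expansion of \<open>(K + L)\<^bsup>s + t\<^esup>\<close> is divisible by \<open>K\<^sup>s\<close> or by
  \<open>L\<^sup>t\<close>.
\<close>

lemma subspace_annihilating_forms:
  fixes J :: "'k::field mpoly set"
  assumes J: "ideal J (S_ring n)" and f: "f \<in> polys {0..n}"
  shows "mpoly.subspace (annihilating_forms n J f)"
  unfolding mpoly.subspace_def
proof (intro conjI ballI allI)
  have "(0 :: 'k mpoly) ^ 1 * f \<in> J" using ideal_0[OF J] by simp
  then show "0 \<in> annihilating_forms n J f"
    unfolding annihilating_forms_def using forms_0 by blast
next
  fix K L assume "K \<in> annihilating_forms n J f" "L \<in> annihilating_forms n J f"
  then obtain s t where K: "K \<in> forms n 1" "K ^ s * f \<in> J" and L: "L \<in> forms n 1" "L ^ t * f \<in> J"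
    by (auto simp: annihilating_forms_def)
  note KS = forms_polys[OF K(1)] and LS = forms_polys[OF L(1)]
  have "of_nat (s + t choose k) * K ^ k * L ^ (s + t - k) * f \<in> J" for k
  proof -
    have c: "(of_nat (s + t choose k) :: 'k mpoly) \<in> polys {0..n}"
      using polys_sum[of "{..<s + t choose k}" "\<lambda>_. 1" "{0..n}"] by simp
    show ?thesis
    proof (cases "s \<le> k")
      case True
      then have "(of_nat (s + t choose k) * L ^ (s + t - k)) * (K ^ k * f) \<in> J"
        by (intro ideal_mult[OF J] polys_mult c polys_power LS
            power_mult_mem_ideal_mono[OF J KS K(2)])
      then show ?thesis by (simp add: ac_simps)
    next
      case False
      then have "(of_nat (s + t choose k) * K ^ k) * (L ^ (s + t - k) * f) \<in> J"
        by (intro ideal_mult[OF J] polys_mult c polys_power KS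
            power_mult_mem_ideal_mono[OF J LS L(2)]) simp
      then show ?thesis by (simp add: ac_simps)
    qed
  qed
  then have "(K + L) ^ (s + t) * f \<in> J"
    unfolding binomial_ring sum_distrib_right by (intro ideal_sum[OF J])
  then show "K + L \<in> annihilating_forms n J f"
    using forms_add[OF K(1) L(1)] by (auto simp: annihilating_forms_def)
next
  fix c L assume "L \<in> annihilating_forms n J f"
  then obtain t where L: "L \<in> forms n 1" "L ^ t * f \<in> J"
    by (auto simp: annihilating_forms_def)
  have "const c ^ t * (L ^ t * f) \<in> J"
    by (intro ideal_mult[OF J] polys_power polys_const L)
  then have "scale c L ^ t * f \<in> J"
    by (simp add: scale_def power_mult_distrib mult.assoc)
  then show "scale c L \<in> annihilating_forms n J f"
    using forms_scale[OF L(1)] by (auto simp: annihilating_forms_def)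
qed

text \<open>
  Let \<open>t i\<close> be such that \<open>y\<^sub>i\<close> to the power \<open>t i\<close> multiplies \<open>f\<close> into \<open>J\<close>.  A power product in
  which each \<open>y\<^sub>i\<close> has exponent less than \<open>t i\<close> has degree less than the sum of all \<open>t i\<close>, so every
  power product of at least that degree multiplies \<open>f\<close> into \<open>J\<close>.
\<close>

lemma saturation_iff_annihilating_forms:
  assumes J: "ideal J (S_ring n)"
  shows "f \<in> saturation n J \<longleftrightarrow> f \<in> polys {0..n} \<and> annihilating_forms n J f = forms n 1"
proof
  assume f: "f \<in> saturation n J"
  then obtain t :: nat where
    t: "\<forall>g \<in> irrelevant_ideal n [^]\<^bsub>ideals_set (S_ring n)\<^esub> t. f * g \<in> J"
    by (auto simp: saturation_def)
  have "L ^ t * f \<in> J" if "L \<in> forms n 1" for L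
    using t linear_form_power_in_irrelevant_ideal_power[OF that, of t] by (metis mult.commute)
  with f show "f \<in> polys {0..n} \<and> annihilating_forms n J f = forms n 1"
    by (auto simp: saturation_def annihilating_forms_def)
next
  assume "f \<in> polys {0..n} \<and> annihilating_forms n J f = forms n 1"
  then have f: "f \<in> polys {0..n}" and "\<forall>i\<in>{..n}. \<exists>t. var i ^ t * f \<in> J"
    using var_in_forms[of _ n] by (auto simp: annihilating_forms_def)
  then obtain t where t: "\<And>i. i \<le> n \<Longrightarrow> var i ^ t i * f \<in> J"
    by (metis atMost_iff)
  have "f * g \<in> J" if "g \<in> irrelevant_ideal n [^]\<^bsub>ideals_set (S_ring n)\<^esub> sum t {..n}" for g
  proof -
    have "f * Poly_Mapping.single m c \<in> J" if m: "m \<in> Poly_Mapping.keys g" for m c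
    proof -
      have V: "Poly_Mapping.keys m \<subseteq> {0..n}" and deg: "sum t {..n} \<le> mdeg m"
        using irrelevant_ideal_power_mdeg[OF \<open>g \<in> _\<close>] m by (auto simp: polys_def)
      have "\<exists>i\<le>n. t i \<le> Poly_Mapping.lookup m i"
      proof (rule ccontr)
        assume "\<not> ?thesis"
        then have "Poly_Mapping.lookup m i < t i" if "i \<le> n" for i
          using that by (meson not_le)
        then have "(\<Sum>i\<le>n. Poly_Mapping.lookup m i) < sum t {..n}"
          by (intro sum_strict_mono) auto
        moreover have "mdeg m = (\<Sum>i\<le>n. Poly_Mapping.lookup m i)"
          using V by (intro mdeg_superset) auto
        ultimately show False using deg by simp
      qed
      then obtain i where i: "i \<le> n" "t i \<le> Poly_Mapping.lookup m i" by blast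
      define m' where "m' = m - Poly_Mapping.single i (t i)"
      have "m = m' + Poly_Mapping.single i (t i)"
        by (rule poly_mapping_eqI)
          (use i in \<open>auto simp: m'_def lookup_add lookup_minus lookup_single when_def\<close>)
      then have "f * Poly_Mapping.single m c = Poly_Mapping.single m' c * (var i ^ t i * f)"
        by (simp add: var_power mult_single ac_simps)
      moreover have "Poly_Mapping.single m' c \<in> polys {0..n}"
        using V by (auto simp: polys_def m'_def in_keys_iff lookup_minus subset_iff)
      ultimately show ?thesis using ideal_mult[OF J] t[OF i(1)] by simp
    qed
    then have "(\<Sum>m\<in>Poly_Mapping.keys g. f * Poly_Mapping.single m (Poly_Mapping.lookup g m)) \<in> J"
      by (rule ideal_sum[OF J])
    then show ?thesis by (simp flip: sum_distrib_left mpoly_eq_sum_single)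
  qed
  with f show "f \<in> saturation n J" by (auto simp: saturation_def)
qed

lemma saturation_mono: "J \<subseteq> J' \<Longrightarrow> saturation n J \<subseteq> saturation n J'"
  unfolding saturation_def by blast

lemma ideal_subset_saturation:
  assumes J: "ideal J (S_ring n)"
  shows "J \<subseteq> saturation n J"
proof
  fix f assume f: "f \<in> J"
  then have "L ^ 0 * f \<in> J" for L by simp
  then show "f \<in> saturation n J"
    using f ideal_polys[OF J] unfolding saturation_iff_annihilating_forms[OF J]
    by (auto simp: annihilating_forms_def intro: exI[of _ 0])
qed

lemma ideal_saturation:
  assumes J: "ideal J (S_ring n)"
  shows "ideal (saturation n J) (S_ring n)"
proof (rule ideal_poly_ringI)
  note iff = saturation_iff_annihilating_forms[OF J]
  show "saturation n J \<subseteq> polys {0..n}" by (auto simp: saturation_def)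
  show "0 \<in> saturation n J" using ideal_subset_saturation[OF J] ideal_0[OF J] by blast
  fix f g assume f: "f \<in> saturation n J" and g: "g \<in> saturation n J"
  have "\<exists>t. L ^ t * (f + g) \<in> J" if L: "L \<in> forms n 1" for L
  proof -
    obtain s t where st: "L ^ s * f \<in> J" "L ^ t * g \<in> J"
      using f g L unfolding iff annihilating_forms_def by blast
    have "L ^ (s + t) * f + L ^ (s + t) * g \<in> J"
      by (intro ideal_add[OF J] power_mult_mem_ideal_mono[OF J forms_polys[OF L] st(1)]
          power_mult_mem_ideal_mono[OF J forms_polys[OF L] st(2)]) auto
    then show ?thesis by (metis distrib_left)
  qed
  with f g show "f + g \<in> saturation n J"
    unfolding iff by (auto simp: annihilating_forms_def intro: polys_add)
next
  note iff = saturation_iff_annihilating_forms[OF J]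
  fix r f :: "'a mpoly" assume r: "r \<in> polys {0..n}" and f: "f \<in> saturation n J"
  have "\<exists>t. L ^ t * (r * f) \<in> J" if L: "L \<in> forms n 1" for L
  proof -
    obtain t where "L ^ t * f \<in> J" using f L unfolding iff annihilating_forms_def by blast
    then have "r * (L ^ t * f) \<in> J" by (rule ideal_mult[OF J r])
    then show ?thesis by (metis mult.left_commute)
  qed
  with r f show "r * f \<in> saturation n J"
    unfolding iff by (auto simp: annihilating_forms_def intro: polys_mult)
qed

lemma saturation_idem:
  assumes J: "ideal J (S_ring n)"
  shows "saturation n (saturation n J) = saturation n J"
proof
  note iff = saturation_iff_annihilating_forms[OF J]
  show "saturation n (saturation n J) \<subseteq> saturation n J"
  proof
    fix f assume f: "f \<in> saturation n (saturation n J)"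
    have "\<exists>t. L ^ t * f \<in> J" if L: "L \<in> forms n 1" for L
    proof -
      obtain s where "L ^ s * f \<in> saturation n J"
        using f L unfolding saturation_iff_annihilating_forms[OF ideal_saturation[OF J]]
          annihilating_forms_def by blast
      then obtain t where "L ^ t * (L ^ s * f) \<in> J"
        using L unfolding iff annihilating_forms_def by blast
      then show ?thesis by (metis mult.assoc power_add)
    qed
    with f show "f \<in> saturation n J"
      unfolding iff by (auto simp: annihilating_forms_def saturation_def)
  qed
  show "saturation n J \<subseteq> saturation n (saturation n J)"
    by (rule ideal_subset_saturation[OF ideal_saturation[OF J]])
qed

text \<open>
  If \<open>f\<close> is in the saturation of \<open>J\<close>, then some \<open>L\<^sup>t f\<close> is in \<open>J\<close>, and it has the same
  dehomogenization as \<open>f\<close>.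
\<close>

lemma dehom_saturation_subset:
  assumes L: "L \<in> forms n 1" and adapted: "adapted_coords n L \<sigma>"
    and J: "ideal J (S_ring n)"
  shows "dehom \<sigma> ` saturation n J \<subseteq> dehom \<sigma> ` J"
proof
  fix q assume "q \<in> dehom \<sigma> ` saturation n J"
  then obtain f where f: "f \<in> saturation n J" "q = dehom \<sigma> f" by blast
  then obtain t where "L ^ t * f \<in> J"
    using L unfolding saturation_iff_annihilating_forms[OF J] annihilating_forms_def by blast
  then show "q \<in> dehom \<sigma> ` J"
    using dehom_adapted_form_power_mult[OF L adapted, of t f] f(2) by (metis imageI)
qed


section \<open>Bases of the dehomogenized ideal\<close>

text \<open>
  Otherwise the class of \<open>b\<close> would be a zero vector in a linearly independent family.
\<close>

lemma standard_basis_not_in_old_part: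
  assumes B: "standard_basis n I B" and b: "b \<in> set B" "b \<in> forms n d"
  shows "b \<notin> old_part n I d"
proof
  assume "b \<in> old_part n I d"
  then have *: "(\<Sum>c\<in>{b}. scale 1 c) \<in> old_part n I d" by simp
  have "quotient_basis (I \<inter> forms n d) (old_part n I d) (set B \<inter> forms n d)"
    using B by (simp add: standard_basis_def)
  then have "finite {b} \<and> {b} \<subseteq> set B \<inter> forms n d \<and> (\<Sum>c\<in>{b}. scale 1 c) \<in> old_part n I d
      \<longrightarrow> (\<forall>c\<in>{b}. (1 :: 'a) = 0)"
    unfolding quotient_basis_def
    by (elim conjE allE[of _ "{b}"] allE[of _ "\<lambda>_. 1 :: 'a"])
  then show False using * b by simp
qed

text \<open>
  If \<open>b\<close> and \<open>c\<close> have the same image and the degree of \<open>c\<close> is not smaller, then \<open>c\<close> is the product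
  of \<open>b\<close> and a power of \<open>L\<close>.  A positive power would put \<open>c\<close> into the space spanned by products of
  elements of \<open>I\<close> of the preceding degree with linear forms.
\<close>

lemma dehom_inj_on_standard_basis:
  assumes L: "L \<in> forms n 1" and adapted: "adapted_coords n L \<sigma>"
    and B: "standard_basis n I B"
  shows "inj_on (dehom \<sigma>) (set B)"
proof -
  have forms: "set B \<subseteq> (\<Union>d. forms n d)" and I: "I = Idl\<^bsub>S_ring n\<^esub> (set B)"
    using B by (auto simp: standard_basis_def)
  have S: "set B \<subseteq> polys {0..n}" using forms by (auto simp: forms_def)
  note ideal_I = ideal_Idl[OF S, folded I]
  have *: "b = c" if b: "b \<in> set B" "b \<in> forms n d" and c: "c \<in> set B" "c \<in> forms n e"
    and eq: "dehom \<sigma> b = dehom \<sigma> c" and le: "d \<le> e" for b c d e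
  proof (cases "d = e")
    case True
    then show ?thesis using inj_onD[OF dehom_inj_on_forms[OF L adapted] eq] b c by blast
  next
    case False
    define k where "k = e - d - 1"
    have e: "e = Suc (k + d)" using False le by (simp add: k_def)
    have "L ^ Suc k * b = c"
    proof (rule inj_onD[OF dehom_inj_on_forms[OF L adapted, of e]])
      show "L ^ Suc k * b \<in> forms n e"
        using forms_mult[OF forms_power[OF L, of "Suc k"] b(2)] e by simp
      show "dehom \<sigma> (L ^ Suc k * b) = dehom \<sigma> c"
        using eq dehom_adapted_form_power_mult[OF L adapted, of "Suc k" b] by simp
    qed (rule c)
    then have "c = (L ^ k * b) * L" by (simp add: ac_simps)
    moreover have "L ^ k * b \<in> I \<inter> forms n (k + d)"
      using forms_mult[OF forms_power[OF L, of k] b(2)] Idl_superset[OF S] b(1)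
      by (auto simp: I intro!: ideal_mult[OF ideal_Idl[OF S]] polys_power forms_polys[OF L])
    ultimately have "c \<in> old_part n I e"
      unfolding old_part_def using L e by (intro mpoly.span_base) blast
    then show ?thesis using standard_basis_not_in_old_part[OF B c] by blast
  qed
  show ?thesis
  proof (rule inj_onI)
    fix b c assume bc: "b \<in> set B" "c \<in> set B" "dehom \<sigma> b = dehom \<sigma> c"
    then obtain d e where "b \<in> forms n d" "c \<in> forms n e" using forms by blast
    then show "b = c"
      using *[of b d c e] *[of c e b d] bc by (cases "d \<le> e") auto
  qed
qed

lemma Idl_insert_eq_iff:
  assumes "insert b G \<subseteq> polys V"
  shows "Idl\<^bsub>poly_ring V\<^esub> G = Idl\<^bsub>poly_ring V\<^esub> (insert b G) \<longleftrightarrow> b \<in> Idl\<^bsub>poly_ring V\<^esub> G"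
proof
  have G: "G \<subseteq> polys V" using assms by simp
  show "b \<in> Idl\<^bsub>poly_ring V\<^esub> G" if "Idl\<^bsub>poly_ring V\<^esub> G = Idl\<^bsub>poly_ring V\<^esub> (insert b G)"
    using that Idl_superset[OF assms] by auto
  show "Idl\<^bsub>poly_ring V\<^esub> G = Idl\<^bsub>poly_ring V\<^esub> (insert b G)" if "b \<in> Idl\<^bsub>poly_ring V\<^esub> G"
  proof
    show "Idl\<^bsub>poly_ring V\<^esub> G \<subseteq> Idl\<^bsub>poly_ring V\<^esub> (insert b G)" using assms by (intro Idl_mono) auto
    show "Idl\<^bsub>poly_ring V\<^esub> (insert b G) \<subseteq> Idl\<^bsub>poly_ring V\<^esub> G"
      using that Idl_superset[OF G] by (intro Idl_minimal ideal_Idl G) auto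
  qed
qed

text \<open>
  Injectivity of dehomogenization on \<open>G\<close> ensures that omitting \<open>b\<^sub>*\<close> from the image of \<open>G\<close> amounts to
  omitting \<open>b\<close> alone from \<open>G\<close>.
\<close>

lemma not_ideal_basis_dehom_iff:
  assumes L: "L \<in> forms n 1" and adapted: "adapted_coords n L \<sigma>"
    and G: "G \<subseteq> (\<Union>d. forms n d)" and inj: "inj_on (dehom \<sigma>) G"
    and J: "Idl\<^bsub>affine_ring n\<^esub> (dehom \<sigma> ` G) = J"
  shows "\<not> ideal_basis n J (dehom \<sigma> ` G) \<longleftrightarrow>
    (\<exists>b\<in>G. L \<in> annihilating_forms n (Idl\<^bsub>S_ring n\<^esub> (G - {b})) b)"
proof -
  have S: "dehom \<sigma> ` G \<subseteq> polys {1..n}"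
    using G dehom_polys[OF L adapted] by (auto simp: forms_def)
  have "Idl\<^bsub>affine_ring n\<^esub> (dehom \<sigma> ` G - {dehom \<sigma> b}) = J \<longleftrightarrow>
      L \<in> annihilating_forms n (Idl\<^bsub>S_ring n\<^esub> (G - {b})) b" if b: "b \<in> G" for b
  proof -
    obtain d where d: "b \<in> forms n d" using G b by blast
    have "dehom \<sigma> ` G - {dehom \<sigma> b} = dehom \<sigma> ` (G - {b})"
      using inj_on_image_set_diff[OF inj, of G "{b}"] b by simp
    moreover have "insert (dehom \<sigma> b) (dehom \<sigma> ` (G - {b})) = dehom \<sigma> ` G"
      using b by blast
    ultimately have "Idl\<^bsub>affine_ring n\<^esub> (dehom \<sigma> ` G - {dehom \<sigma> b}) = J \<longleftrightarrow>
        dehom \<sigma> b \<in> Idl\<^bsub>affine_ring n\<^esub> (dehom \<sigma> ` (G - {b}))"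
      using Idl_insert_eq_iff[of "dehom \<sigma> b" "dehom \<sigma> ` (G - {b})" "{1..n}"] S J by simp
    also have "\<dots> \<longleftrightarrow> (\<exists>t. L ^ t * b \<in> Idl\<^bsub>S_ring n\<^esub> (G - {b}))"
      using G by (intro dehom_mem_Idl_iff[OF L adapted _ d]) blast
    finally show ?thesis using L by (simp add: annihilating_forms_def)
  qed
  then show ?thesis using S J by (auto simp: ideal_basis_def)
qed

text \<open>
  Otherwise, as saturation is idempotent, omitting \<open>b\<close> in addition to \<open>T\<close> would not change the
  saturation, and \<open>T \<union> {b}\<close> would be a larger inessential set.
\<close>

lemma maximal_inessential_complement_not_saturated:
  assumes B: "standard_basis n I B" and T: "maximal_inessential n I B T"
    and b: "b \<in> set B - T"
  shows "b \<notin> saturation n (Idl\<^bsub>S_ring n\<^esub> (set B - T - {b}))"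
proof
  let ?G = "set B - T"
  assume sat: "b \<in> saturation n (Idl\<^bsub>S_ring n\<^esub> (?G - {b}))"
  have "set B \<subseteq> polys {0..n}" using B by (auto simp: standard_basis_def forms_def)
  then have G: "?G \<subseteq> polys {0..n}" by blast
  then have G': "?G - {b} \<subseteq> polys {0..n}" by blast
  note J = ideal_Idl[OF G']
  have "?G \<subseteq> saturation n (Idl\<^bsub>S_ring n\<^esub> (?G - {b}))"
    using sat Idl_superset[OF G'] ideal_subset_saturation[OF J] by blast
  then have "Idl\<^bsub>S_ring n\<^esub> ?G \<subseteq> saturation n (Idl\<^bsub>S_ring n\<^esub> (?G - {b}))"
    by (rule Idl_minimal[OF ideal_saturation[OF J]])
  then have "saturation n (Idl\<^bsub>S_ring n\<^esub> ?G) \<subseteq> saturation n (Idl\<^bsub>S_ring n\<^esub> (?G - {b}))"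
    using saturation_mono saturation_idem[OF J] by metis
  moreover have "saturation n (Idl\<^bsub>S_ring n\<^esub> (?G - {b})) \<subseteq> saturation n (Idl\<^bsub>S_ring n\<^esub> ?G)"
    by (intro saturation_mono Idl_mono G) blast
  moreover have "?G - {b} = set B - insert b T" by blast
  ultimately have "inessential n I B (insert b T)"
    using T b by (auto simp: maximal_inessential_def inessential_def)
  then show False using T b unfolding maximal_inessential_def by blast
qed

theorem proposition5p5:
  fixes n :: nat
    and I :: "'k::alg_closed_field mpoly set"
    and bs cs :: "'k mpoly list"
  assumes "homogeneous_ideal n I"
    and "saturation n I \<subset> irrelevant_ideal n"
    and "standard_basis n I (bs @ cs)"
    and "maximal_inessential n I (bs @ cs) (set cs)"
  shows "(\<forall>L\<in>forms n 1. \<forall>\<sigma>. L \<noteq> 0 \<and> adapted_coords n L \<sigma> \<longrightarrow>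
            Idl\<^bsub>affine_ring n\<^esub> (dehom \<sigma> ` set bs) = dehom \<sigma> ` I) \<and>
         (\<exists>\<V>. finite \<V> \<and> (\<forall>V\<in>\<V>. mpoly.subspace V \<and> V \<subset> forms n 1) \<and>
            (\<forall>L\<in>forms n 1. \<forall>\<sigma>. L \<noteq> 0 \<and> adapted_coords n L \<sigma> \<longrightarrow>
              (\<not> ideal_basis n (dehom \<sigma> ` I) (dehom \<sigma> ` set bs) \<longleftrightarrow> L \<in> \<Union>\<V>)))"
proof -
  note B = assms(3) and T = assms(4)
  have forms: "set (bs @ cs) \<subseteq> (\<Union>d. forms n d)" and I: "I = Idl\<^bsub>S_ring n\<^esub> (set (bs @ cs))"
    and G: "set (bs @ cs) - set cs = set bs"
    using B by (auto simp: standard_basis_def)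
  have S: "set (bs @ cs) \<subseteq> polys {0..n}" using forms by (auto simp: forms_def)
  then have bS: "set bs \<subseteq> polys {0..n}" by simp
  note J = ideal_Idl[OF bS]
  have sat: "saturation n I = saturation n (Idl\<^bsub>S_ring n\<^esub> (set bs))"
    using T G by (simp add: maximal_inessential_def inessential_def)
  have gen: "Idl\<^bsub>affine_ring n\<^esub> (dehom \<sigma> ` set bs) = dehom \<sigma> ` I"
    if L: "L \<in> forms n 1" "adapted_coords n L \<sigma>" for L \<sigma>
  proof -
    have "dehom \<sigma> ` I \<subseteq> dehom \<sigma> ` (Idl\<^bsub>S_ring n\<^esub> (set bs))"
      using dehom_saturation_subset[OF L J] ideal_subset_saturation[OF ideal_Idl[OF S, folded I]] sat
      by blast
    moreover have "Idl\<^bsub>S_ring n\<^esub> (set bs) \<subseteq> I" unfolding I by (rule Idl_mono[OF _ S]) simp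
    ultimately show ?thesis using dehom_image_Idl[OF L bS] by blast
  qed
  define V where "V b = annihilating_forms n (Idl\<^bsub>S_ring n\<^esub> (set bs - {b})) b" for b
  have "mpoly.subspace (V b) \<and> V b \<subset> forms n 1" if b: "b \<in> set bs" for b
  proof -
    have J': "ideal (Idl\<^bsub>S_ring n\<^esub> (set bs - {b})) (S_ring n)" using bS by (intro ideal_Idl) blast
    have "b \<notin> saturation n (Idl\<^bsub>S_ring n\<^esub> (set bs - {b}))"
      using maximal_inessential_complement_not_saturated[OF B T, of b] G b by metis
    then have "V b \<noteq> forms n 1"
      using saturation_iff_annihilating_forms[OF J', of b] b bS by (auto simp: V_def)
    moreover have "V b \<subseteq> forms n 1" by (auto simp: V_def annihilating_forms_def)
    ultimately show ?thesis
      using subspace_annihilating_forms[OF J', of b] b bS by (auto simp: V_def)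
  qed
  moreover have "\<not> ideal_basis n (dehom \<sigma> ` I) (dehom \<sigma> ` set bs) \<longleftrightarrow> L \<in> \<Union>(V ` set bs)"
    if L: "L \<in> forms n 1" "adapted_coords n L \<sigma>" for L \<sigma>
  proof -
    have "inj_on (dehom \<sigma>) (set bs)"
      using dehom_inj_on_standard_basis[OF L B] by (rule inj_on_subset) simp
    then show ?thesis
      using not_ideal_basis_dehom_iff[OF L _ _ gen[OF L]] forms by (simp add: V_def)
  qed
  ultimately show ?thesis
    using gen by (intro conjI exI[of _ "V ` set bs"]) auto
qed

end
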